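(* Let $\Omega\subset\mathbb{R}^d$ and let $\rho,\eta\ge 0$ be scalars. Consider the operator $$\mathcal{A}=\begin{bmatrix}\rho&-\operatorname{div}\\-\nabla&\eta\end{bmatrix}:\ L^2(\Omega)\times L^2(\Omega;\mathbb{R}^d)\supset H^1(\Omega)\times H(\operatorname{div};\Omega)\to L^2(\Omega)\times L^2(\Omega;\mathbb{R}^d)$$ and its decomposition $\mathcal{A}=\mathcal{H}+\mathcal{S}$ with $$\mathcal{H}=\begin{bmatrix}\rho&0\\0&\eta\end{bmatrix}:\ L^2(\Omega)\times L^2(\Omega;\mathbb{R}^d)\to L^2(\Omega)\times L^2(\Omega;\mathbb{R}^d)$$ and $$\mathcal{S}=\begin{bmatrix}0&-\operatorname{div}\\-\nabla&0\end{bmatrix}:\ L^2(\Omega)\times L^2(\Omega;\mathbb{R}^d)\supset H^1(\Omega)\times H(\operatorname{div};\Omega)\to L^2(\Omega)\times L^2(\Omega;\mathbb{R}^d).$$ Let $X\in\{L^2(\Omega)\times L^2(\Omega;\mathbb{R}^d),\ H^1(\Omega)\times H(\operatorname{div};\Omega)\}$. Then $\mathcal{H}^{-1}\mathcal{S}:X\to X$ is unbounded.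
   Context: The operator $\mathcal{A}$ governs the stationary, first-order port-Hamiltonian form of the wave equation with momentum damping: $-\operatorname{div}q+\rho p=f_1$ and $-\nabla p+\eta q=f_2$ on $\Omega$, with boundary condition $n^\top q=0$ on $\partial\Omega$, where $p:\Omega\to\mathbb{R}$ is the momentum, $q:\Omega\to\mathbb{R}^d$ the strain, and $\rho,\eta$ are friction parameters. $\mathcal{H}$ plays the role of the self-adjoint part and $\mathcal{S}$ that of the skew-adjoint part of $\mathcal{A}$. $H(\operatorname{div};\Omega)$ is the space of vector fields $\Omega\to\mathbb{R}^d$ with components in $L^2(\Omega)$ whose weak divergence belongs to $L^2(\Omega)$. $\mathcal{H}^{-1}$ denotes the inverse of the multiplication operator $\mathcal{H}$. A densely defined operator $\mathcal{T}:X\supset\operatorname{dom}(\mathcal{T})\to X$ is called unbounded on $(X,\|\cdot\|)$ if there is no $c\ge0$ such that $\|\mathcal{T}x\|\le c\|x\|$ for all $x\in\operatorname{dom}(\mathcal{T})$; here $\mathcal{H}^{-1}\mathcal{S}$ is considered on those $x\in X$ for which $\mathcal{H}^{-1}\mathcal{S}x$ is defined and lies in $X$. *)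

theory Defs
  imports "HOL-Analysis.Analysis" "HOL-Library.Function_Algebras"
begin

text \<open>
  Elements of \<open>L\<^sup>2(\<Omega>)\<close> are represented by functions on the whole space, and functions that agree
  almost everywhere on \<open>\<Omega>\<close> are not identified; what is called a norm below is therefore a seminorm
  whose kernel consists of the functions vanishing almost everywhere on \<open>\<Omega>\<close>. All spaces, norms and
  weak derivatives respect equality almost everywhere on \<open>\<Omega>\<close>.
\<close>

subsection \<open>Test functions\<close>

definition partial_deriv :: "'n::finite \<Rightarrow> (real^'n \<Rightarrow> real) \<Rightarrow> real^'n \<Rightarrow> real" where
  "partial_deriv i f x = frechet_derivative f (at x) (axis i 1)"

primrec Ck :: "nat \<Rightarrow> (real^'n::finite \<Rightarrow> real) \<Rightarrow> bool" where
  "Ck 0 f \<longleftrightarrow> continuous_on UNIV f"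
| "Ck (Suc k) f \<longleftrightarrow> (\<forall>x. f differentiable (at x)) \<and> (\<forall>i. Ck k (partial_deriv i f))"

definition test_functions :: "(real^'n::finite) set \<Rightarrow> (real^'n \<Rightarrow> real) set" where
  "test_functions \<Omega> = {\<phi>. (\<forall>k. Ck k \<phi>) \<and>
     compact (closure {x. \<phi> x \<noteq> 0}) \<and> closure {x. \<phi> x \<noteq> 0} \<subseteq> \<Omega>}"

subsection \<open>The spaces \<open>L\<^sup>2\<close>, \<open>H\<^sup>1\<close> and \<open>H(div)\<close>\<close>

definition L2 :: "(real^'n::finite) set \<Rightarrow> (real^'n \<Rightarrow> 'b::euclidean_space) set" where
  "L2 \<Omega> = {f. f \<in> borel_measurable (lebesgue_on \<Omega>) \<and>
     integrable (lebesgue_on \<Omega>) (\<lambda>x. (norm (f x))\<^sup>2)}"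

definition L2_norm :: "(real^'n::finite) set \<Rightarrow> (real^'n \<Rightarrow> 'b::euclidean_space) \<Rightarrow> real" where
  "L2_norm \<Omega> f = sqrt (integral\<^sup>L (lebesgue_on \<Omega>) (\<lambda>x. (norm (f x))\<^sup>2))"

definition has_weak_grad ::
  "(real^'n::finite) set \<Rightarrow> (real^'n \<Rightarrow> real) \<Rightarrow> (real^'n \<Rightarrow> real^'n) \<Rightarrow> bool" where
  "has_weak_grad \<Omega> p g \<longleftrightarrow> (\<forall>\<phi>\<in>test_functions \<Omega>. \<forall>i.
     integral\<^sup>L (lebesgue_on \<Omega>) (\<lambda>x. p x * partial_deriv i \<phi> x)
       = - integral\<^sup>L (lebesgue_on \<Omega>) (\<lambda>x. g x $ i * \<phi> x))"

definition has_weak_div ::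
  "(real^'n::finite) set \<Rightarrow> (real^'n \<Rightarrow> real^'n) \<Rightarrow> (real^'n \<Rightarrow> real) \<Rightarrow> bool" where
  "has_weak_div \<Omega> q g \<longleftrightarrow> (\<forall>\<phi>\<in>test_functions \<Omega>.
     integral\<^sup>L (lebesgue_on \<Omega>) (\<lambda>x. \<Sum>i\<in>UNIV. q x $ i * partial_deriv i \<phi> x)
       = - integral\<^sup>L (lebesgue_on \<Omega>) (\<lambda>x. g x * \<phi> x))"

definition H1 :: "(real^'n::finite) set \<Rightarrow> (real^'n \<Rightarrow> real) set" where
  "H1 \<Omega> = {p \<in> L2 \<Omega>. \<exists>g\<in>L2 \<Omega>. has_weak_grad \<Omega> p g}"

definition Hdiv :: "(real^'n::finite) set \<Rightarrow> (real^'n \<Rightarrow> real^'n) set" where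
  "Hdiv \<Omega> = {q \<in> L2 \<Omega>. \<exists>g\<in>L2 \<Omega>. has_weak_div \<Omega> q g}"

text \<open>
  Weak derivatives are unique up to equality almost everywhere on the open set \<open>\<Omega>\<close>; the choice below
  picks a representative, the same one for arguments that agree almost everywhere on \<open>\<Omega>\<close>.
\<close>

definition weak_grad :: "(real^'n::finite) set \<Rightarrow> (real^'n \<Rightarrow> real) \<Rightarrow> real^'n \<Rightarrow> real^'n" where
  "weak_grad \<Omega> p = (SOME g. g \<in> L2 \<Omega> \<and> has_weak_grad \<Omega> p g)"

definition weak_div :: "(real^'n::finite) set \<Rightarrow> (real^'n \<Rightarrow> real^'n) \<Rightarrow> real^'n \<Rightarrow> real" where
  "weak_div \<Omega> q = (SOME g. g \<in> L2 \<Omega> \<and> has_weak_div \<Omega> q g)"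

type_synonym 'n state = "(real^'n \<Rightarrow> real) \<times> (real^'n \<Rightarrow> real^'n)"

definition L2_state :: "(real^'n::finite) set \<Rightarrow> 'n state set" where
  "L2_state \<Omega> = L2 \<Omega> \<times> L2 \<Omega>"

definition L2_state_norm :: "(real^'n::finite) set \<Rightarrow> 'n state \<Rightarrow> real" where
  "L2_state_norm \<Omega> = (\<lambda>(p, q). sqrt ((L2_norm \<Omega> p)\<^sup>2 + (L2_norm \<Omega> q)\<^sup>2))"

definition H1_Hdiv :: "(real^'n::finite) set \<Rightarrow> 'n state set" where
  "H1_Hdiv \<Omega> = H1 \<Omega> \<times> Hdiv \<Omega>"

definition H1_Hdiv_norm :: "(real^'n::finite) set \<Rightarrow> 'n state \<Rightarrow> real" where
  "H1_Hdiv_norm \<Omega> = (\<lambda>(p, q).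
     sqrt ((L2_norm \<Omega> p)\<^sup>2 + (L2_norm \<Omega> (weak_grad \<Omega> p))\<^sup>2
         + (L2_norm \<Omega> q)\<^sup>2 + (L2_norm \<Omega> (weak_div \<Omega> q))\<^sup>2))"

subsection \<open>The operators\<close>

definition op_A :: "real \<Rightarrow> real \<Rightarrow> (real^'n::finite) set \<Rightarrow> 'n state \<Rightarrow> 'n state" where
  "op_A \<rho> \<eta> \<Omega> = (\<lambda>(p, q).
     ((\<lambda>x. \<rho> * p x - weak_div \<Omega> q x), (\<lambda>x. - weak_grad \<Omega> p x + \<eta> *\<^sub>R q x)))"

definition op_H :: "real \<Rightarrow> real \<Rightarrow> 'n::finite state \<Rightarrow> 'n state" where
  "op_H \<rho> \<eta> = (\<lambda>(p, q). ((\<lambda>x. \<rho> * p x), (\<lambda>x. \<eta> *\<^sub>R q x)))"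

definition op_S :: "(real^'n::finite) set \<Rightarrow> 'n state \<Rightarrow> 'n state" where
  "op_S \<Omega> = (\<lambda>(p, q). ((\<lambda>x. - weak_div \<Omega> q x), (\<lambda>x. - weak_grad \<Omega> p x)))"

lemma op_A_decomposition: "op_A \<rho> \<eta> \<Omega> x = op_H \<rho> \<eta> x + op_S \<Omega> x"
  by (cases x) (simp add: op_A_def op_H_def op_S_def plus_fun_def)

text \<open>
  \<open>op_A\<close> and \<open>op_S\<close> are meant on the domain \<open>H1_Hdiv \<Omega>\<close> and \<open>op_H\<close> on \<open>L2_state \<Omega>\<close>. The inverse
  of \<open>op_H\<close> is meaningful if \<open>op_H\<close> is a bijection of \<open>L2_state \<Omega>\<close>; the pointwise inverse of the
  representatives then also inverts it modulo equality almost everywhere.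
\<close>

definition op_H_inv :: "real \<Rightarrow> real \<Rightarrow> (real^'n::finite) set \<Rightarrow> 'n state \<Rightarrow> 'n state" where
  "op_H_inv \<rho> \<eta> \<Omega> = the_inv_into (L2_state \<Omega>) (op_H \<rho> \<eta>)"

definition op_HinvS :: "real \<Rightarrow> real \<Rightarrow> (real^'n::finite) set \<Rightarrow> 'n state \<Rightarrow> 'n state" where
  "op_HinvS \<rho> \<eta> \<Omega> = op_H_inv \<rho> \<eta> \<Omega> \<circ> op_S \<Omega>"

definition dom_HinvS ::
  "real \<Rightarrow> real \<Rightarrow> (real^'n::finite) set \<Rightarrow> 'n state set \<Rightarrow> 'n state set" where
  "dom_HinvS \<rho> \<eta> \<Omega> X = {x \<in> X. x \<in> H1_Hdiv \<Omega> \<and>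
     op_S \<Omega> x \<in> op_H \<rho> \<eta> ` L2_state \<Omega> \<and> op_HinvS \<rho> \<eta> \<Omega> x \<in> X}"

subsection \<open>Unbounded operators\<close>

text \<open>Being densely defined is part of the notion.\<close>

definition unbounded_operator ::
  "'a::minus set \<Rightarrow> ('a \<Rightarrow> real) \<Rightarrow> 'a set \<Rightarrow> ('a \<Rightarrow> 'a) \<Rightarrow> bool" where
  "unbounded_operator X nrm D T \<longleftrightarrow>
     D \<subseteq> X \<and> T ` D \<subseteq> X \<and>
     (\<forall>x\<in>X. \<forall>\<epsilon>>0. \<exists>y\<in>D. nrm (x - y) < \<epsilon>) \<and>
     \<not> (\<exists>c\<ge>0. \<forall>x\<in>D. nrm (T x) \<le> c * nrm x)"

end

theory Submission
  imports Defs
begin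

text \<open>
  Both claims about \<open>H\<^sup>-\<^sup>1S\<close> rest on the duality between gradient and divergence.

  Unboundedness: for a test function \<open>p\<close> supported in a slab of width \<open>\<delta>\<close>, integrating the derivative
  of \<open>(x\<^sub>i - c) p\<^sup>2\<close> gives \<open>\<parallel>p\<parallel> \<le> \<delta> \<parallel>\<nabla>p\<parallel>\<close>, and \<open>\<parallel>\<nabla>p\<parallel>\<^sup>2 = - \<langle>p, \<Delta>p\<rangle>\<close> then gives \<open>\<parallel>\<nabla>p\<parallel> \<le> \<delta> \<parallel>\<Delta>p\<parallel>\<close>.
  Hence \<open>(p, 0)\<close> is stretched by a factor of order \<open>1 / \<delta>\<close> in either norm.

  Density of the domain: in \<open>L\<^sup>2\<close> it contains the test functions. In the graph norm, no regularity of the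
  boundary is available, so smooth approximation does not help. Instead, the domain of \<open>T\<^sup>*T\<close> is a core
  of \<open>T\<close> for every closed densely defined \<open>T\<close>. For \<open>T\<close> the weak gradient, elements \<open>p\<close> of the core
  have \<open>\<nabla>p\<close> in \<open>H(div)\<close>, and for \<open>T\<close> the weak divergence, elements \<open>q\<close> have \<open>div q\<close> in \<open>H\<^sup>1\<close>.
\<close>

subsection \<open>Completeness of \<open>L\<^sup>2\<close> and orthogonal projections\<close>

text \<open>\<open>L2_norm\<close> is only a seminorm on functions, and \<open>weak_grad\<close> and
  \<open>weak_div\<close> are choices: even the gradient of a test function or the divergence of the
  zero field is known only almost everywhere. Derivatives are therefore handled as relations, and
  the chosen value enters through uniqueness almost everywhere.

  The domains carry no boundary condition, so weak gradient and minus weak divergence are not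
  adjoint to each other; the adjoint of either has a vanishing trace built in. One inclusion is
  enough: an adjoint relation tested on test functions alone already is a weak derivative. This
  places the core inside the domain of \<open>op_HinvS\<close>, for both operators by the same
  abstract argument.

  Bijectivity of \<open>op_H\<close> enters through injectivity, which makes both friction
  parameters nonzero. Up to null sets \<open>op_HinvS\<close> sends (p, 0) to (0, -\<nabla>p /
  \<eta>), so the scale to beat is 1 / \<bar>\<eta>\<bar>. In the graph norm the pair of norms of p
  and \<nabla>p is compared with the pair of norms of \<nabla>p and \<Delta>p, entry by
  entry.\<close>

definition L2_inner :: "(real^'n::finite) set \<Rightarrow> (real^'n \<Rightarrow> 'b::euclidean_space) \<Rightarrow> (real^'n \<Rightarrow> 'b) \<Rightarrow> real" where
  "L2_inner \<Omega> f g = integral\<^sup>L (lebesgue_on \<Omega>) (\<lambda>x. f x \<bullet> g x)"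

lemma L2_measurable: "f \<in> L2 \<Omega> \<Longrightarrow> f \<in> borel_measurable (lebesgue_on \<Omega>)"
  by (simp add: L2_def)

lemma L2_integrable_square: "f \<in> L2 \<Omega> \<Longrightarrow> integrable (lebesgue_on \<Omega>) (\<lambda>x. (norm (f x))\<^sup>2)"
  by (simp add: L2_def)

lemma L2_integrable_inner:
  assumes "f \<in> L2 \<Omega>" "g \<in> L2 \<Omega>"
  shows "integrable (lebesgue_on \<Omega>) (\<lambda>x. f x \<bullet> g x)"
proof (rule Bochner_Integration.integrable_bound)
  show "integrable (lebesgue_on \<Omega>) (\<lambda>x. (norm (f x))\<^sup>2 + (norm (g x))\<^sup>2)"
    using assms by (simp add: L2_def)
  show "(\<lambda>x. f x \<bullet> g x) \<in> borel_measurable (lebesgue_on \<Omega>)"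
    using assms by (auto simp: L2_def)
  have "\<bar>f x \<bullet> g x\<bar> \<le> (norm (f x))\<^sup>2 + (norm (g x))\<^sup>2" for x
    using Cauchy_Schwarz_ineq2[of "f x" "g x"] sum_squares_bound[of "norm (f x)" "norm (g x)"]
      mult_nonneg_nonneg[OF norm_ge_zero norm_ge_zero, of "f x" "g x"] by linarith
  then show "AE x in lebesgue_on \<Omega>. norm (f x \<bullet> g x) \<le> norm ((norm (f x))\<^sup>2 + (norm (g x))\<^sup>2)"
    by (intro AE_I2) (metis abs_ge_self order_trans real_norm_def)
qed

lemma L2_add:
  assumes "f \<in> L2 \<Omega>" "g \<in> L2 \<Omega>"
  shows "(\<lambda>x. f x + g x) \<in> L2 \<Omega>"
proof -
  have eq: "(norm (f x + g x))\<^sup>2 = (norm (f x))\<^sup>2 + 2 * (f x \<bullet> g x) + (norm (g x))\<^sup>2" for x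
    by (simp add: power2_norm_eq_inner inner_add inner_commute)
  show ?thesis
    using assms L2_integrable_inner[OF assms] unfolding L2_def by (auto simp: eq)
qed

lemma L2_scaleR: "f \<in> L2 \<Omega> \<Longrightarrow> (\<lambda>x. c *\<^sub>R f x) \<in> L2 \<Omega>"
  by (auto simp: L2_def power_mult_distrib)

lemma L2_mult: "f \<in> L2 \<Omega> \<Longrightarrow> (\<lambda>x. c * f x) \<in> L2 \<Omega>" for f :: "real^'n::finite \<Rightarrow> real"
  using L2_scaleR[of f \<Omega> c] by simp

lemma L2_uminus: "f \<in> L2 \<Omega> \<Longrightarrow> (\<lambda>x. - f x) \<in> L2 \<Omega>"
  using L2_scaleR[of f \<Omega> "-1"] by simp

lemma L2_diff: "f \<in> L2 \<Omega> \<Longrightarrow> g \<in> L2 \<Omega> \<Longrightarrow> (\<lambda>x. f x - g x) \<in> L2 \<Omega>"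
  using L2_add[of f \<Omega> "\<lambda>x. - g x"] by (simp add: L2_uminus)

lemma L2_zero: "(\<lambda>x. 0) \<in> L2 \<Omega>"
  by (simp add: L2_def)

lemma L2_inner_commute: "L2_inner \<Omega> f g = L2_inner \<Omega> g f"
  by (simp add: L2_inner_def inner_commute)

lemma L2_inner_add_left:
  "f \<in> L2 \<Omega> \<Longrightarrow> g \<in> L2 \<Omega> \<Longrightarrow> h \<in> L2 \<Omega> \<Longrightarrow>
    L2_inner \<Omega> (\<lambda>x. f x + g x) h = L2_inner \<Omega> f h + L2_inner \<Omega> g h"
  by (simp add: L2_inner_def inner_add_left L2_integrable_inner)

lemma L2_inner_diff_left:
  "f \<in> L2 \<Omega> \<Longrightarrow> g \<in> L2 \<Omega> \<Longrightarrow> h \<in> L2 \<Omega> \<Longrightarrow>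
    L2_inner \<Omega> (\<lambda>x. f x - g x) h = L2_inner \<Omega> f h - L2_inner \<Omega> g h"
  by (simp add: L2_inner_def inner_diff_left L2_integrable_inner)

lemma L2_inner_scaleR_left: "L2_inner \<Omega> (\<lambda>x. c *\<^sub>R f x) h = c * L2_inner \<Omega> f h"
  by (simp add: L2_inner_def)

lemma L2_inner_minus_left: "L2_inner \<Omega> (\<lambda>x. - f x) h = - L2_inner \<Omega> f h"
  by (simp add: L2_inner_def)

lemma L2_norm_nonneg [simp]: "0 \<le> L2_norm \<Omega> f"
  by (simp add: L2_norm_def)

lemma L2_norm_square: "(L2_norm \<Omega> f)\<^sup>2 = L2_inner \<Omega> f f"
  by (simp add: L2_norm_def L2_inner_def power2_norm_eq_inner)

lemma L2_norm_scaleR: "L2_norm \<Omega> (\<lambda>x. c *\<^sub>R f x) = \<bar>c\<bar> * L2_norm \<Omega> f"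
  by (simp add: L2_norm_def power_mult_distrib real_sqrt_mult)

lemma L2_norm_mult: "L2_norm \<Omega> (\<lambda>x. c * f x) = \<bar>c\<bar> * L2_norm \<Omega> f"
  for f :: "real^'n::finite \<Rightarrow> real"
  using L2_norm_scaleR[of \<Omega> c f] by simp

lemma L2_norm_uminus: "L2_norm \<Omega> (\<lambda>x. - f x) = L2_norm \<Omega> f"
  by (simp add: L2_norm_def)

lemma L2_norm_diff_commute: "L2_norm \<Omega> (\<lambda>x. f x - g x) = L2_norm \<Omega> (\<lambda>x. g x - f x)"
  by (simp add: L2_norm_def norm_minus_commute)

lemma L2_norm_square_diff_scaleR:
  assumes "f \<in> L2 \<Omega>" "g \<in> L2 \<Omega>"
  shows "(L2_norm \<Omega> (\<lambda>x. f x - t *\<^sub>R g x))\<^sup>2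
    = (L2_norm \<Omega> f)\<^sup>2 - 2 * t * L2_inner \<Omega> f g + t\<^sup>2 * (L2_norm \<Omega> g)\<^sup>2"
proof -
  have eq: "(f x - t *\<^sub>R g x) \<bullet> (f x - t *\<^sub>R g x) =
      f x \<bullet> f x - 2 * t * (f x \<bullet> g x) + t\<^sup>2 * (g x \<bullet> g x)" for x
    by (simp add: inner_diff inner_commute power2_eq_square algebra_simps)
  show ?thesis
    using assms by (simp add: L2_norm_square L2_inner_def eq L2_integrable_inner)
qed

text \<open>Serves Cauchy-Schwarz and also the projection, where the quadratic expresses minimality
  up to a small error. The case c = 0 has to be covered because a seminorm may vanish on nonzero
  functions.\<close>

lemma quadratic_nonneg_imp_discriminant_le:
  fixes a b c :: real
  assumes "\<And>t. 0 \<le> a - 2 * t * b + t\<^sup>2 * c" "c \<ge> 0"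
  shows "b\<^sup>2 \<le> a * c"
proof (cases "c = 0")
  case True
  have "b = 0"
  proof (rule ccontr)
    assume "b \<noteq> 0"
    \<comment> \<open>For this t the linear expression a - 2 * t * b equals -1.\<close>
    then show False
      using assms(1)[of "(a + 1) / (2 * b)"] True by (simp add: field_simps)
  qed
  then show ?thesis by (simp add: True)
next
  case False
  then have "0 \<le> a - b\<^sup>2 / c"
    using assms(1)[of "b / c"] by (simp add: field_simps power2_eq_square)
  then show ?thesis
    using False assms(2) by (simp add: field_simps)
qed

lemma L2_Cauchy_Schwarz:
  assumes "f \<in> L2 \<Omega>" "g \<in> L2 \<Omega>"
  shows "\<bar>L2_inner \<Omega> f g\<bar> \<le> L2_norm \<Omega> f * L2_norm \<Omega> g"
proof -
  have "0 \<le> (L2_norm \<Omega> f)\<^sup>2 - 2 * t * L2_inner \<Omega> f g + t\<^sup>2 * (L2_norm \<Omega> g)\<^sup>2" for t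
    by (metis L2_norm_square_diff_scaleR[OF assms] zero_le_power2)
  then have "(L2_inner \<Omega> f g)\<^sup>2 \<le> (L2_norm \<Omega> f)\<^sup>2 * (L2_norm \<Omega> g)\<^sup>2"
    by (rule quadratic_nonneg_imp_discriminant_le) simp
  then show ?thesis
    by (metis L2_norm_nonneg abs_le_square_iff abs_mult abs_of_nonneg power_mult_distrib)
qed

lemma L2_norm_triangle:
  assumes "f \<in> L2 \<Omega>" "g \<in> L2 \<Omega>"
  shows "L2_norm \<Omega> (\<lambda>x. f x + g x) \<le> L2_norm \<Omega> f + L2_norm \<Omega> g"
proof -
  have "(L2_norm \<Omega> (\<lambda>x. f x + g x))\<^sup>2 = (L2_norm \<Omega> f)\<^sup>2 + 2 * L2_inner \<Omega> f g + (L2_norm \<Omega> g)\<^sup>2"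
    using L2_norm_square_diff_scaleR[OF assms, of "-1"] by simp
  also have "\<dots> \<le> (L2_norm \<Omega> f + L2_norm \<Omega> g)\<^sup>2"
    using L2_Cauchy_Schwarz[OF assms] by (simp add: power2_sum)
  finally show ?thesis
    by (rule power2_le_imp_le) simp
qed

lemma L2_norm_triangle_diff:
  assumes "f \<in> L2 \<Omega>" "g \<in> L2 \<Omega>" "h \<in> L2 \<Omega>"
  shows "L2_norm \<Omega> (\<lambda>x. f x - h x) \<le> L2_norm \<Omega> (\<lambda>x. f x - g x) + L2_norm \<Omega> (\<lambda>x. g x - h x)"
  using L2_norm_triangle[of "\<lambda>x. f x - g x" \<Omega> "\<lambda>x. g x - h x"] assms by (simp add: L2_diff)

lemma L2_norm_eq_0_iff:
  assumes "f \<in> L2 \<Omega>"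
  shows "L2_norm \<Omega> f = 0 \<longleftrightarrow> (AE x in lebesgue_on \<Omega>. f x = 0)"
  using integral_nonneg_eq_0_iff_AE[OF L2_integrable_square[OF assms]]
  by (simp add: L2_norm_def)

lemma L2_inner_cong_AE:
  assumes "f \<in> L2 \<Omega>" "f' \<in> L2 \<Omega>" "g \<in> L2 \<Omega>" "AE x in lebesgue_on \<Omega>. f x = f' x"
  shows "L2_inner \<Omega> f g = L2_inner \<Omega> f' g"
  unfolding L2_inner_def
  using assms by (intro integral_cong_AE) (auto simp: L2_def elim: AE_mp)

lemma L2_norm_cong_AE:
  assumes "f \<in> L2 \<Omega>" "f' \<in> L2 \<Omega>" "AE x in lebesgue_on \<Omega>. f x = f' x"
  shows "L2_norm \<Omega> f = L2_norm \<Omega> f'"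
  unfolding L2_norm_def
  using assms by (intro arg_cong[where f=sqrt] integral_cong_AE) (auto simp: L2_def elim: AE_mp)

lemma L2_inner_tendsto:
  assumes "\<And>n. f n \<in> L2 \<Omega>" "w \<in> L2 \<Omega>" "g \<in> L2 \<Omega>"
    and "(\<lambda>n. L2_norm \<Omega> (\<lambda>x. f n x - w x)) \<longlonglongrightarrow> 0"
  shows "(\<lambda>n. L2_inner \<Omega> (f n) g) \<longlonglongrightarrow> L2_inner \<Omega> w g"
proof (rule LIM_zero_cancel, rule Lim_null_comparison)
  show "\<forall>\<^sub>F n in sequentially. norm (L2_inner \<Omega> (f n) g - L2_inner \<Omega> w g)
      \<le> L2_norm \<Omega> (\<lambda>x. f n x - w x) * L2_norm \<Omega> g"
    using assms L2_Cauchy_Schwarz[OF L2_diff[OF assms(1,2)] assms(3)]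
    by (simp add: L2_inner_diff_left)
  show "(\<lambda>n. L2_norm \<Omega> (\<lambda>x. f n x - w x) * L2_norm \<Omega> g) \<longlonglongrightarrow> 0"
    using tendsto_mult_left_zero[OF assms(4)] by simp
qed

text \<open>\<Omega> may have infinite measure, so convergence in \<open>L2\<close> need not give
  convergence in the mean. Multiplication by the square root k of a strictly positive integrable
  function repairs this: k lies in \<open>L2\<close>, Cauchy-Schwarz makes k * f n Cauchy in the
  mean, a subsequence converges almost everywhere, and division by k gives the limit of f.\<close>

lemma L2_complete:
  fixes f :: "nat \<Rightarrow> real^'n::finite \<Rightarrow> 'b::euclidean_space"
  assumes \<Omega>: "\<Omega> \<in> sets lebesgue" and f: "\<And>n. f n \<in> L2 \<Omega>"
    and cauchy: "\<And>e. e > 0 \<Longrightarrow> \<exists>N. \<forall>i\<ge>N. \<forall>j\<ge>N. L2_norm \<Omega> (\<lambda>x. f i x - f j x) < e"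
  obtains w where "w \<in> L2 \<Omega>" "(\<lambda>n. L2_norm \<Omega> (\<lambda>x. f n x - w x)) \<longlonglongrightarrow> 0"
proof -
  let ?M = "lebesgue_on \<Omega>"
  note fm [measurable] = L2_measurable[OF f]
  obtain h :: "real^'n \<Rightarrow> real" where h: "h \<in> borel_measurable lborel" "integrable lborel h"
    and hpos: "\<And>x. h x > 0"
    using sigma_finite_measure.obtain_positive_integrable_function[OF sigma_finite_lborel] by metis
  have hint: "integrable ?M h"
  proof -
    have "integrable lebesgue h"
      using h by (simp add: integrable_completion)
    then have "integrable lebesgue (\<lambda>x. indicator \<Omega> x *\<^sub>R h x)"
      using \<Omega> by (intro integrable_mult_indicator)
    then show ?thesis
      using \<Omega> by (simp add: integrable_restrict_space)
  qed
  have [measurable]: "h \<in> borel_measurable ?M"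
    using hint by blast
  define k where "k x = sqrt (h x)" for x
  have "k \<in> borel_measurable ?M"
    unfolding k_def[abs_def] by measurable
  then have k: "k \<in> L2 \<Omega>"
    using hint hpos by (simp add: L2_def k_def less_imp_le)
  have nf: "(\<lambda>x. norm (f i x - f j x)) \<in> L2 \<Omega>" for i j
    using L2_diff[OF f f] by (simp add: L2_def)
  have wf: "integrable ?M (\<lambda>x. k x *\<^sub>R f i x)" for i
  proof (rule Bochner_Integration.integrable_bound)
    have "(\<lambda>x. norm (f i x)) \<in> L2 \<Omega>" using f by (simp add: L2_def)
    from L2_integrable_inner[OF k this]
    show "integrable ?M (\<lambda>x. k x * norm (f i x))" by simp
    show "(\<lambda>x. k x *\<^sub>R f i x) \<in> borel_measurable ?M"
      using L2_measurable[OF k] by measurable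
  qed (simp add: k_def)
  have le: "(LINT x|?M. norm (k x *\<^sub>R f i x - k x *\<^sub>R f j x))
      \<le> L2_norm \<Omega> k * L2_norm \<Omega> (\<lambda>x. f i x - f j x)" for i j
  proof -
    have "(LINT x|?M. norm (k x *\<^sub>R f i x - k x *\<^sub>R f j x))
        = L2_inner \<Omega> k (\<lambda>x. norm (f i x - f j x))"
      using hpos by (simp add: L2_inner_def k_def less_imp_le flip: scaleR_diff_right)
    also have "\<dots> \<le> L2_norm \<Omega> k * L2_norm \<Omega> (\<lambda>x. norm (f i x - f j x))"
      using L2_Cauchy_Schwarz[OF k nf] by (meson abs_ge_self order_trans)
    finally show ?thesis by (simp add: L2_norm_def)
  qed
  have L1: "\<exists>N. \<forall>i\<ge>N. \<forall>j\<ge>N. (LINT x|?M. norm (k x *\<^sub>R f i x - k x *\<^sub>R f j x)) < e" if e: "e > 0" for e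
  proof -
    \<comment> \<open>The summand 1 guards the division: the norm of k is zero if \<Omega> is a null
      set.\<close>
    have pos: "L2_norm \<Omega> k + 1 > 0"
      by (simp add: add_nonneg_pos)
    obtain N where N: "\<And>i j. i \<ge> N \<Longrightarrow> j \<ge> N \<Longrightarrow> L2_norm \<Omega> (\<lambda>x. f i x - f j x) < e / (L2_norm \<Omega> k + 1)"
      using cauchy[of "e / (L2_norm \<Omega> k + 1)"] e pos by (metis divide_pos_pos)
    have "(LINT x|?M. norm (k x *\<^sub>R f i x - k x *\<^sub>R f j x)) < e" if "i \<ge> N" "j \<ge> N" for i j
    proof -
      have "L2_norm \<Omega> k * L2_norm \<Omega> (\<lambda>x. f i x - f j x)
          \<le> (L2_norm \<Omega> k + 1) * L2_norm \<Omega> (\<lambda>x. f i x - f j x)"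
        by (simp add: mult_right_mono)
      also have "\<dots> < e"
        using N[OF that] pos by (simp add: field_simps)
      finally show ?thesis
        using le[of i j] by linarith
    qed
    then show ?thesis by blast
  qed
  obtain r where r: "strict_mono r" and ae: "AE x in ?M. Cauchy (\<lambda>i. k x *\<^sub>R f (r i) x)"
    by (rule cauchy_L1_AE_cauchy_subseq[of ?M "\<lambda>i x. k x *\<^sub>R f i x", OF wf L1])
  define w where "w x = lim (\<lambda>i. f (r i) x)" for x
  have [measurable]: "w \<in> borel_measurable ?M"
    unfolding w_def by measurable
  have conv: "AE x in ?M. (\<lambda>i. f (r i) x) \<longlonglongrightarrow> w x"
    using ae
  proof eventually_elim
    case (elim x)
    then have "convergent (\<lambda>i. k x *\<^sub>R f (r i) x)"
      by (simp add: Cauchy_convergent_iff)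
    then obtain l where "(\<lambda>i. k x *\<^sub>R f (r i) x) \<longlonglongrightarrow> l"
      by (auto simp: convergent_def)
    then have "(\<lambda>i. inverse (k x) *\<^sub>R (k x *\<^sub>R f (r i) x)) \<longlonglongrightarrow> inverse (k x) *\<^sub>R l"
      by (intro tendsto_intros)
    then have "convergent (\<lambda>i. f (r i) x)"
      using hpos[of x] by (auto simp: convergent_def k_def)
    then show ?case
      by (simp add: w_def convergent_LIMSEQ_iff)
  qed
  \<comment> \<open>Fatou's lemma along the subsequence, with n fixed, bounds the distance of f n
    from w for every large n, not only on the subsequence. Membership in \<open>L2\<close> comes out
    at the same time.\<close>
  have key: "(\<lambda>x. f n x - w x) \<in> L2 \<Omega> \<and> L2_norm \<Omega> (\<lambda>x. f n x - w x) \<le> e"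
    if e: "e > 0" and N: "\<forall>i\<ge>N. \<forall>j\<ge>N. L2_norm \<Omega> (\<lambda>x. f i x - f j x) < e" and n: "n \<ge> N" for e N n
  proof -
    have "(\<integral>\<^sup>+x. ennreal ((norm (f n x - w x))\<^sup>2) \<partial>?M)
        = (\<integral>\<^sup>+x. liminf (\<lambda>i. ennreal ((norm (f n x - f (r i) x))\<^sup>2)) \<partial>?M)"
    proof (rule nn_integral_cong_AE, use conv in eventually_elim)
      case (elim x)
      have "(\<lambda>i. ennreal ((norm (f n x - f (r i) x))\<^sup>2)) \<longlonglongrightarrow> ennreal ((norm (f n x - w x))\<^sup>2)"
        by (intro tendsto_intros elim)
      then show ?case
        by (metis lim_imp_Liminf trivial_limit_sequentially)
    qed
    also have "\<dots> \<le> liminf (\<lambda>i. \<integral>\<^sup>+x. ennreal ((norm (f n x - f (r i) x))\<^sup>2) \<partial>?M)"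
      by (rule nn_integral_liminf) measurable
    also have "\<dots> \<le> liminf (\<lambda>i::nat. ennreal (e\<^sup>2))"
    proof (rule Liminf_mono, rule eventually_sequentiallyI)
      fix i assume "i \<ge> N"
      then have "r i \<ge> N"
        using seq_suble[OF r, of i] by linarith
      then have "L2_norm \<Omega> (\<lambda>x. f n x - f (r i) x) < e"
        using N n by blast
      then have "(L2_norm \<Omega> (\<lambda>x. f n x - f (r i) x))\<^sup>2 \<le> e\<^sup>2"
        by (intro power_mono) auto
      moreover have "(\<integral>\<^sup>+x. ennreal ((norm (f n x - f (r i) x))\<^sup>2) \<partial>?M)
          = ennreal ((L2_norm \<Omega> (\<lambda>x. f n x - f (r i) x))\<^sup>2)"
        using L2_integrable_square[OF L2_diff[OF f f]]
        by (subst nn_integral_eq_integral) (auto simp: L2_norm_def)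
      ultimately show "(\<integral>\<^sup>+x. ennreal ((norm (f n x - f (r i) x))\<^sup>2) \<partial>?M) \<le> ennreal (e\<^sup>2)"
        by (simp add: ennreal_leI)
    qed
    also have "\<dots> = ennreal (e\<^sup>2)"
      by (simp add: Liminf_const)
    finally have b: "(\<integral>\<^sup>+x. ennreal ((norm (f n x - w x))\<^sup>2) \<partial>?M) \<le> ennreal (e\<^sup>2)" .
    then have "integrable ?M (\<lambda>x. (norm (f n x - w x))\<^sup>2)"
      by (intro integrableI_bounded) (auto intro: le_less_trans)
    then have L: "(\<lambda>x. f n x - w x) \<in> L2 \<Omega>"
      by (simp add: L2_def)
    have "ennreal ((L2_norm \<Omega> (\<lambda>x. f n x - w x))\<^sup>2) \<le> ennreal (e\<^sup>2)"
      using b L2_integrable_square[OF L] by (subst (asm) nn_integral_eq_integral) (auto simp: L2_norm_def)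
    then have "(L2_norm \<Omega> (\<lambda>x. f n x - w x))\<^sup>2 \<le> e\<^sup>2"
      by (simp only: ennreal_le_iff zero_le_power2)
    then have "L2_norm \<Omega> (\<lambda>x. f n x - w x) \<le> e"
      by (rule power2_le_imp_le) (use e in simp)
    with L show ?thesis by blast
  qed
  have "w \<in> L2 \<Omega>"
  proof -
    obtain N where "\<forall>i\<ge>N. \<forall>j\<ge>N. L2_norm \<Omega> (\<lambda>x. f i x - f j x) < 1"
      using cauchy[of 1] by auto
    from key[OF _ this] have "(\<lambda>x. f N x - w x) \<in> L2 \<Omega>" by simp
    from L2_diff[OF f[of N] this] show ?thesis by simp
  qed
  moreover have "(\<lambda>n. L2_norm \<Omega> (\<lambda>x. f n x - w x)) \<longlonglongrightarrow> 0"
  proof (rule LIMSEQ_I)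
    fix e :: real assume e: "e > 0"
    obtain N where N: "\<forall>i\<ge>N. \<forall>j\<ge>N. L2_norm \<Omega> (\<lambda>x. f i x - f j x) < e / 2"
      using cauchy[of "e / 2"] e by auto
    have "norm (L2_norm \<Omega> (\<lambda>x. f n x - w x) - 0) < e" if "n \<ge> N" for n
      using key[OF _ N that] e by simp
    then show "\<exists>N. \<forall>n\<ge>N. norm (L2_norm \<Omega> (\<lambda>x. f n x - w x) - 0) < e" by blast
  qed
  ultimately show thesis by (rule that)
qed

text \<open>G is a subspace that need not be closed, so w lies in its closure only. The minimizing
  sequence is returned as well: closed G then recover w as an element, and a vanishing residual
  turns the sequence into an approximation of u.\<close>

lemma L2_projection:
  fixes u :: "real^'n::finite \<Rightarrow> 'b::euclidean_space"
  assumes \<Omega>: "\<Omega> \<in> sets lebesgue" and u: "u \<in> L2 \<Omega>"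
    and G: "G \<subseteq> L2 \<Omega>" and ne: "G \<noteq> {}"
    and sub: "\<And>f g c. f \<in> G \<Longrightarrow> g \<in> G \<Longrightarrow> (\<lambda>x. f x + c *\<^sub>R g x) \<in> G"
  obtains w f where "w \<in> L2 \<Omega>" "\<And>n::nat. f n \<in> G"
    "(\<lambda>n. L2_norm \<Omega> (\<lambda>x. f n x - w x)) \<longlonglongrightarrow> 0"
    "\<And>g. g \<in> G \<Longrightarrow> L2_inner \<Omega> (\<lambda>x. u x - w x) g = 0"
proof -
  define N where "N g = (L2_norm \<Omega> (\<lambda>x. u x - g x))\<^sup>2" for g
  define d where "d = Inf (N ` G)"
  have bdd: "bdd_below (N ` G)"
    by (rule bdd_belowI[of _ 0]) (auto simp: N_def)
  have d: "d \<le> N g" if "g \<in> G" for g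
    unfolding d_def using that bdd by (intro cINF_lower) auto
  have "\<exists>g\<in>G. N g < d + inverse (real (Suc n))" for n
    using cInf_lessD[of "N ` G" "d + inverse (real (Suc n))"] ne unfolding d_def
    by (auto simp del: of_nat_Suc)
  then obtain f where fG: "\<And>n::nat. f n \<in> G" and fN: "\<And>n. N (f n) < d + inverse (real (Suc n))"
    by metis
  have GL: "g \<in> L2 \<Omega>" if "g \<in> G" for g using G that by blast
  have scale: "(\<lambda>x. c *\<^sub>R g x) \<in> G" if "g \<in> G" for g c
    using sub[OF that that, of "c - 1"] by (simp add: algebra_simps)
  have cau: "(L2_norm \<Omega> (\<lambda>x. f i x - f j x))\<^sup>2 \<le> 2 * inverse (real (Suc i)) + 2 * inverse (real (Suc j))" for i j
  proof -
    \<comment> \<open>Parallelogram law: the midpoint \<open>?m\<close> of two almost minimizers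
      lies in G, hence is no closer to u than the infimum d.\<close>
    let ?a = "\<lambda>x. u x - f i x" and ?b = "\<lambda>x. u x - f j x" and ?m = "\<lambda>x. (1/2) *\<^sub>R (f i x + 1 *\<^sub>R f j x)"
    have a: "?a \<in> L2 \<Omega>" and b: "?b \<in> L2 \<Omega>"
      using u GL[OF fG] by (auto intro: L2_diff)
    have m: "?m \<in> G"
      by (intro scale sub fG)
    have "(\<lambda>x. ?a x - (-1) *\<^sub>R ?b x) = (\<lambda>x. 2 *\<^sub>R (u x - ?m x))"
      by (auto simp: algebra_simps scaleR_2)
    then have "(L2_norm \<Omega> (\<lambda>x. ?a x - (-1) *\<^sub>R ?b x))\<^sup>2 = 4 * N ?m"
      unfolding N_def by (simp add: L2_norm_scaleR power_mult_distrib)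
    moreover have "(\<lambda>x. ?a x - 1 *\<^sub>R ?b x) = (\<lambda>x. - (f i x - f j x))"
      by auto
    then have "(L2_norm \<Omega> (\<lambda>x. ?a x - 1 *\<^sub>R ?b x))\<^sup>2 = (L2_norm \<Omega> (\<lambda>x. f i x - f j x))\<^sup>2"
      by (simp only: L2_norm_uminus)
    ultimately have "(L2_norm \<Omega> (\<lambda>x. f i x - f j x))\<^sup>2 = 2 * N (f i) + 2 * N (f j) - 4 * N ?m"
      using L2_norm_square_diff_scaleR[OF a b, of 1] L2_norm_square_diff_scaleR[OF a b, of "-1"]
      unfolding N_def by simp
    then show ?thesis
      using d[OF m] fN[of i] fN[of j] by linarith
  qed
  have cauchy: "\<exists>M. \<forall>i\<ge>M. \<forall>j\<ge>M. L2_norm \<Omega> (\<lambda>x. f i x - f j x) < e" if e: "e > 0" for e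
  proof -
    obtain M where M: "inverse (real (Suc M)) < e\<^sup>2 / 4"
      using reals_Archimedean[of "e\<^sup>2 / 4"] e by auto
    have "L2_norm \<Omega> (\<lambda>x. f i x - f j x) < e" if "i \<ge> M" "j \<ge> M" for i j
    proof -
      have "inverse (real (Suc i)) \<le> inverse (real (Suc M))" "inverse (real (Suc j)) \<le> inverse (real (Suc M))"
        using that by (auto intro!: le_imp_inverse_le)
      then have "(L2_norm \<Omega> (\<lambda>x. f i x - f j x))\<^sup>2 < e\<^sup>2"
        using cau[of i j] M by linarith
      then show ?thesis
        using e by (meson less_imp_le power_less_imp_less_base)
    qed
    then show ?thesis by blast
  qed
  obtain w where w: "w \<in> L2 \<Omega>" and lim: "(\<lambda>n. L2_norm \<Omega> (\<lambda>x. f n x - w x)) \<longlonglongrightarrow> 0"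
    by (rule L2_complete[OF \<Omega> GL[OF fG] cauchy])
  have "L2_inner \<Omega> (\<lambda>x. u x - w x) g = 0" if g: "g \<in> G" for g
  proof -
    \<comment> \<open>Moving from f n in the direction g cannot gain more than the defect 1 / (n +
      1), for any step t; the discriminant then bounds the inner product.\<close>
    have "(L2_inner \<Omega> (\<lambda>x. u x - f n x) g)\<^sup>2 \<le> inverse (real (Suc n)) * (L2_norm \<Omega> g)\<^sup>2" for n
    proof (rule quadratic_nonneg_imp_discriminant_le)
      fix t
      have "d \<le> N (\<lambda>x. f n x + t *\<^sub>R g x)"
        by (intro d sub fG g)
      also have "\<dots> = N (f n) - 2 * t * L2_inner \<Omega> (\<lambda>x. u x - f n x) g + t\<^sup>2 * (L2_norm \<Omega> g)\<^sup>2"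
        unfolding N_def using L2_norm_square_diff_scaleR[OF L2_diff[OF u GL[OF fG]] GL[OF g], of n t]
        by (simp add: diff_diff_eq)
      finally show "0 \<le> inverse (real (Suc n)) - 2 * t * L2_inner \<Omega> (\<lambda>x. u x - f n x) g + t\<^sup>2 * (L2_norm \<Omega> g)\<^sup>2"
        using fN[of n] by linarith
    qed simp
    moreover have "(\<lambda>n. (L2_inner \<Omega> (\<lambda>x. u x - f n x) g)\<^sup>2) \<longlonglongrightarrow> (L2_inner \<Omega> (\<lambda>x. u x - w x) g)\<^sup>2"
      using L2_inner_tendsto[OF GL[OF fG] w GL[OF g] lim]
      by (simp add: L2_inner_diff_left u w GL fG g tendsto_intros)
    moreover have "(\<lambda>n. inverse (real (Suc n)) * (L2_norm \<Omega> g)\<^sup>2) \<longlonglongrightarrow> 0"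
      using tendsto_mult_left_zero[OF LIMSEQ_inverse_real_of_nat] by simp
    ultimately have "(L2_inner \<Omega> (\<lambda>x. u x - w x) g)\<^sup>2 \<le> 0"
      by (intro LIMSEQ_le) auto
    then show ?thesis by simp
  qed
  with w fG lim show thesis by (rule that)
qed

subsection \<open>Smooth functions with compact support\<close>

lemma partial_derivI: "(f has_derivative f') (at x) \<Longrightarrow> partial_deriv i f x = f' (axis i 1)"
  by (simp add: partial_deriv_def frechet_derivative_at[symmetric])

lemma Ck_Suc_imp: "Ck (Suc k) f \<Longrightarrow> Ck k f"
proof (induction k arbitrary: f)
  case 0
  then show ?case
    by (auto intro!: continuous_at_imp_continuous_on differentiable_imp_continuous_within)
next
  case (Suc k)
  then show ?case
    by (metis Ck.simps(2))
qed

lemma Ck_const: "Ck k (\<lambda>x. c)"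
proof (induction k arbitrary: c)
  case (Suc k)
  have "partial_deriv i (\<lambda>x. c) = (\<lambda>x. 0)" for i :: 'a
    by (auto simp: partial_deriv_def)
  with Suc show ?case by simp
qed simp

lemma partial_deriv_add:
  "f differentiable at x \<Longrightarrow> g differentiable at x \<Longrightarrow>
    partial_deriv i (\<lambda>x. f x + g x) x = partial_deriv i f x + partial_deriv i g x"
  unfolding partial_deriv_def
  by (subst frechet_derivative_at[symmetric, OF has_derivative_add])
    (auto simp: frechet_derivative_works)

lemma partial_deriv_mult:
  "f differentiable at x \<Longrightarrow> g differentiable at x \<Longrightarrow>
    partial_deriv i (\<lambda>x. f x * g x) x = f x * partial_deriv i g x + partial_deriv i f x * g x"
  unfolding partial_deriv_def
  by (subst frechet_derivative_at[symmetric, OF has_derivative_mult])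
    (auto simp: frechet_derivative_works)

lemma Ck_add: "Ck k f \<Longrightarrow> Ck k g \<Longrightarrow> Ck k (\<lambda>x. f x + g x)"
proof (induction k arbitrary: f g)
  case 0
  then show ?case by (auto intro: continuous_on_add)
next
  case (Suc k)
  then have "partial_deriv i (\<lambda>x. f x + g x) = (\<lambda>x. partial_deriv i f x + partial_deriv i g x)" for i
    by (auto simp: partial_deriv_add)
  with Suc show ?case by auto
qed

lemma Ck_mult: "Ck k f \<Longrightarrow> Ck k g \<Longrightarrow> Ck k (\<lambda>x. f x * g x)"
proof (induction k arbitrary: f g)
  case 0
  then show ?case by (auto intro: continuous_on_mult)
next
  case (Suc k)
  then have "partial_deriv i (\<lambda>x. f x * g x) = (\<lambda>x. f x * partial_deriv i g x + partial_deriv i f x * g x)" for i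
    by (auto simp: partial_deriv_mult)
  then have "Ck k (partial_deriv i (\<lambda>x. f x * g x))" for i
    using Suc.prems by (auto intro!: Suc.IH Ck_add intro: Ck_Suc_imp)
  with Suc.prems show ?case by auto
qed

lemma Ck_cmult: "Ck k f \<Longrightarrow> Ck k (\<lambda>x. c * f x)"
  by (intro Ck_mult Ck_const)

lemma Ck_diff: "Ck k f \<Longrightarrow> Ck k g \<Longrightarrow> Ck k (\<lambda>x. f x - g x)"
  using Ck_add[of k f "\<lambda>x. -1 * g x"] Ck_cmult[of k g "-1"] by simp

lemma Ck_power: "Ck k f \<Longrightarrow> Ck k (\<lambda>x. f x ^ n)"
  by (induction n) (auto intro: Ck_const Ck_mult)

lemma Ck_prod: "finite I \<Longrightarrow> (\<And>i. i \<in> I \<Longrightarrow> Ck k (f i)) \<Longrightarrow> Ck k (\<lambda>x. \<Prod>i\<in>I. f i x)"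
  by (induction I rule: finite_induct) (auto intro: Ck_const Ck_mult)

lemma partial_deriv_affine_comp:
  assumes "(F has_real_derivative D) (at (s * x $ i + c))"
  shows "(\<lambda>x. F (s * x $ i + c)) differentiable at x"
    and "partial_deriv j (\<lambda>x. F (s * x $ i + c)) x = (if j = i then s * D else 0)"
proof -
  have "((\<lambda>x. s * x $ i + c) has_derivative (\<lambda>h. s * h $ i)) (at x)"
    by (auto intro!: derivative_eq_intros bounded_linear.has_derivative[OF bounded_linear_vec_nth])
  then have d: "((\<lambda>x. F (s * x $ i + c)) has_derivative (\<lambda>h. D * (s * h $ i))) (at x)"
    using assms unfolding has_field_derivative_def
    by (rule has_derivative_compose[where g=F])
  then show "(\<lambda>x. F (s * x $ i + c)) differentiable at x"
    by (auto simp: differentiable_def)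
  show "partial_deriv j (\<lambda>x. F (s * x $ i + c)) x = (if j = i then s * D else 0)"
    using partial_derivI[OF d] by (simp add: axis_def)
qed

lemma Ck_coordinate: "Ck k (\<lambda>x. x $ i + c)"
proof (cases k)
  case (Suc m)
  have "partial_deriv j (\<lambda>x::real^'a. x $ i + c) = (\<lambda>x. if j = i then 1 else 0)" for j
    using partial_deriv_affine_comp(2)[of "\<lambda>x. x" 1 1 _ i c j] by auto
  moreover have "(\<lambda>x::real^'a. x $ i + c) differentiable at x" for x
    using partial_deriv_affine_comp(1)[of "\<lambda>x. x" 1 1 x i c] by auto
  ultimately show ?thesis
    by (simp add: Suc Ck_const)
qed (auto intro!: continuous_intros)

text \<open>The powers of \<open>1 / t\<close> make the family closed under differentiation, up to linear combinations.\<close>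

definition flat :: "nat \<Rightarrow> real \<Rightarrow> real" where
  "flat m t = (if t > 0 then (1 / t) ^ m * exp (- (1 / t)) else 0)"

lemma power_le_fact_exp: "0 \<le> s \<Longrightarrow> s ^ k \<le> fact k * exp s" for s :: real
proof -
  assume s: "0 \<le> s"
  have "(\<lambda>n. s ^ n /\<^sub>R fact n) sums exp s"
    by (rule exp_converges)
  then have "(\<Sum>n\<in>{k}. s ^ n /\<^sub>R fact n) \<le> exp s"
    using s by (metis (no_types, lifting) sum_le_suminf sums_iff finite.emptyI finite.insertI fact_ge_zero
      inverse_nonnegative_iff_nonnegative scaleR_nonneg_nonneg zero_le_power)
  then show ?thesis
    by (simp add: field_simps)
qed

text \<open>One term of the exponential series at 1 / t, of order m + 2, absorbs the powers of 1 / t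
  and leaves a factor \<open>t\<^sup>2\<close>, enough for the difference quotient at 0 to tend to
  0.\<close>

lemma flat_le_square: "flat m t \<le> fact (m + 2) * t\<^sup>2"
proof (cases "t > 0")
  case True
  have "(1 / t) ^ (m + 2) \<le> fact (m + 2) * exp (1 / t)"
    using True by (intro power_le_fact_exp) simp
  then have "(1 / t) ^ (m + 2) * (t\<^sup>2 * exp (- (1/t))) \<le> (fact (m + 2) * exp (1 / t)) * (t\<^sup>2 * exp (- (1/t)))"
    by (intro mult_right_mono) auto
  also have "\<dots> = fact (m + 2) * t\<^sup>2"
    by (simp add: exp_minus)
  also have "(1 / t) ^ (m + 2) * (t\<^sup>2 * exp (- (1/t))) = flat m t"
    using True by (simp add: flat_def power_add power2_eq_square)
  finally show ?thesis .
qed (simp add: flat_def)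

lemma flat_nonneg: "0 \<le> flat m t"
  by (simp add: flat_def)

lemma flat_has_derivative:
  "(flat m has_real_derivative (- real m * flat (m + 1) t + flat (m + 2) t)) (at t)"
proof -
  consider "t > 0" | "t < 0" | "t = 0" by linarith
  then show ?thesis
  proof cases
    case 1
    have eq: "(real m * (1 / t) ^ (m - 1) * (- (1 / t\<^sup>2))) * exp (- (1 / t))
          + (1 / t) ^ m * (exp (- (1 / t)) * (1 / t\<^sup>2))
        = - real m * flat (m + 1) t + flat (m + 2) t"
      using 1 by (cases m)
        (simp_all add: flat_def power2_eq_square algebra_simps add_divide_distrib diff_divide_distrib)
    have "((\<lambda>t. (1 / t) ^ m * exp (- (1 / t))) has_real_derivative
        (- real m * flat (m + 1) t + flat (m + 2) t)) (at t)"
      unfolding eq[symmetric] using 1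
      by (auto intro!: derivative_eq_intros simp: power2_eq_square)
    then show ?thesis
      by (rule has_field_derivative_transform_within_open[where S="{0<..}"]) (use 1 in \<open>auto simp: flat_def\<close>)
  next
    case 2
    have "((\<lambda>t. 0) has_real_derivative (- real m * flat (m + 1) t + flat (m + 2) t)) (at t)"
      using 2 by (auto simp: flat_def)
    then show ?thesis
      by (rule has_field_derivative_transform_within_open[where S="{..<0}"]) (use 2 in \<open>auto simp: flat_def\<close>)
  next
    \<comment> \<open>At the junction of the two formulas the quadratic bound makes the difference
      quotient O(\<bar>h\<bar>).\<close>
    case 3
    have "((\<lambda>h. (flat m (0 + h) - flat m 0) / h) \<longlongrightarrow> 0) (at 0)"
    proof (rule Lim_null_comparison)
      have "norm ((flat m (0 + h) - flat m 0) / h) \<le> fact (m + 2) * \<bar>h\<bar>" if "h \<noteq> 0" for h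
      proof -
        have "\<bar>flat m h\<bar> \<le> (fact (m + 2) * \<bar>h\<bar>) * \<bar>h\<bar>"
          using flat_le_square[of m h] flat_nonneg[of m h] by (simp add: power2_eq_square)
        then show ?thesis
          using that by (simp add: flat_def[of m 0] field_simps)
      qed
      then show "\<forall>\<^sub>F h in at 0. norm ((flat m (0 + h) - flat m 0) / h) \<le> fact (m + 2) * \<bar>h\<bar>"
        by (auto simp: eventually_at_filter)
      show "((\<lambda>h. fact (m + 2) * \<bar>h\<bar>) \<longlongrightarrow> 0) (at (0::real))"
        by (auto intro!: tendsto_eq_intros)
    qed
    then have "(flat m has_real_derivative 0) (at 0)"
      by (simp add: DERIV_def)
    then show ?thesis
      using 3 by (simp add: flat_def)
  qed
qed

lemma Ck_flat: "Ck k (\<lambda>x. flat m (s * x $ i + c))"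
proof (induction k arbitrary: m)
  case 0
  have "flat m differentiable at t" for t
    using flat_has_derivative by (auto simp: real_differentiable_def)
  then have "continuous_on UNIV (flat m)"
    by (intro continuous_at_imp_continuous_on) (auto intro: differentiable_imp_continuous_within)
  then show ?case
    by (auto intro!: continuous_on_compose2[of UNIV "flat m"] continuous_intros)
next
  case (Suc k)
  note d = partial_deriv_affine_comp[OF flat_has_derivative[of m]]
  have eq: "partial_deriv j (\<lambda>x::real^'a. flat m (s * x $ i + c)) =
     (\<lambda>x. (if j = i then s else 0) * (- real m * flat (m + 1) (s * x $ i + c) + flat (m + 2) (s * x $ i + c)))" for j
    by (auto simp: d)
  have "Ck k (partial_deriv j (\<lambda>x::real^'a. flat m (s * x $ i + c)))" for j
    unfolding eq by (intro Ck_cmult Ck_add Suc)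
  then show ?case by (simp add: d(1))
qed

text \<open>Each factor depends on one coordinate through an affine map, so smoothness reduces to
  \<open>Ck_flat\<close>. The product is positive exactly on the open box, where every factor is,
  and takes values in [0, 1].\<close>

definition box_bump :: "real^'n::finite \<Rightarrow> real^'n \<Rightarrow> real^'n \<Rightarrow> real" where
  "box_bump a b x = (\<Prod>i\<in>UNIV. flat 0 (x $ i - a $ i) * flat 0 (b $ i - x $ i))"

lemma Ck_box_bump: "Ck k (box_bump a b)"
proof -
  have "Ck k (\<lambda>x. \<Prod>i\<in>UNIV. flat 0 (1 * x $ i + - a $ i) * flat 0 (-1 * x $ i + b $ i))"
    by (intro Ck_prod Ck_mult Ck_flat) auto
  then show ?thesis by (simp add: box_bump_def[abs_def])
qed

lemma box_bump_pos: "x \<in> box a b \<Longrightarrow> 0 < box_bump a b x"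
  by (auto simp: box_bump_def mem_box_cart flat_def intro!: prod_pos)

lemma box_bump_eq_0: "x \<notin> box a b \<Longrightarrow> box_bump a b x = 0"
  by (fastforce simp: box_bump_def mem_box_cart flat_def)

lemma box_bump_le_1: "box_bump a b x \<le> 1"
  unfolding box_bump_def by (intro prod_le_1) (auto simp: flat_def mult_le_one)

lemma box_bump_nonneg: "0 \<le> box_bump a b x"
  by (metis box_bump_eq_0 box_bump_pos less_imp_le order_refl)

section \<open>Closure properties of test functions\<close>

lemma test_functionI:
  assumes "\<And>k. Ck k \<phi>" "compact K" "K \<subseteq> \<Omega>" "\<And>x. x \<notin> K \<Longrightarrow> \<phi> x = 0"
  shows "\<phi> \<in> test_functions \<Omega>"
proof -
  have "closure {x. \<phi> x \<noteq> 0} \<subseteq> K"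
    using assms(2,4) by (intro closure_minimal compact_imp_closed) auto
  then show ?thesis
    using assms(1,3) compact_Int_closed[OF \<open>compact K\<close> closed_closure, of "{x. \<phi> x \<noteq> 0}"]
    by (simp add: test_functions_def Int_absorb1)
qed

text \<open>These polynomials in the bump vanish outside the box and increase to the indicator of
  the open box as n grows, which gives smooth approximations of indicators without convolution. For
  n = 1 it is the bump itself.\<close>

lemma test_function_box_plateau:
  assumes "cbox a b \<subseteq> \<Omega>"
  shows "(\<lambda>x. 1 - (1 - box_bump a b x) ^ n) \<in> test_functions \<Omega>"
proof (rule test_functionI[where K="cbox a b"])
  show "1 - (1 - box_bump a b x) ^ n = 0" if "x \<notin> cbox a b" for x
    using that box_subset_cbox[of a b] by (subst box_bump_eq_0) auto
  show "Ck k (\<lambda>x. 1 - (1 - box_bump a b x) ^ n)" for k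
    by (intro Ck_diff Ck_power Ck_const Ck_box_bump)
qed (use assms in auto)

lemma test_function_Ck: "\<phi> \<in> test_functions \<Omega> \<Longrightarrow> Ck k \<phi>"
  by (simp add: test_functions_def)

lemma test_function_differentiable: "\<phi> \<in> test_functions \<Omega> \<Longrightarrow> \<phi> differentiable at x"
  using test_function_Ck[of \<phi> \<Omega> 1] by simp

lemma test_function_support:
  assumes "\<phi> \<in> test_functions \<Omega>"
  obtains K where "compact K" "K \<subseteq> \<Omega>" "\<And>x. x \<notin> K \<Longrightarrow> \<phi> x = 0"
  using assms closure_subset[of "{x. \<phi> x \<noteq> 0}"] unfolding test_functions_def
  by (auto intro!: that[of "closure {x. \<phi> x \<noteq> 0}"])

lemma Ck_continuous: "Ck k f \<Longrightarrow> continuous_on UNIV f"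
  by (induction k) (auto dest: Ck_Suc_imp simp del: Ck.simps(2))

lemma partial_deriv_eq_0:
  assumes "closed K" "\<And>y. y \<notin> K \<Longrightarrow> f y = 0" "x \<notin> K"
  shows "partial_deriv i f x = 0"
proof -
  have "(f has_derivative (\<lambda>h. 0)) (at x)"
    by (rule has_derivative_transform_within_open[OF has_derivative_const[of 0], where s="- K"])
      (use assms in \<open>auto simp: open_Compl\<close>)
  then show ?thesis
    by (rule partial_derivI)
qed

lemma test_function_partial_deriv:
  assumes "\<phi> \<in> test_functions \<Omega>"
  shows "partial_deriv i \<phi> \<in> test_functions \<Omega>"
proof -
  obtain K where K: "compact K" "K \<subseteq> \<Omega>" "\<And>x. x \<notin> K \<Longrightarrow> \<phi> x = 0"
    using test_function_support[OF assms] by metis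
  show ?thesis
  proof (rule test_functionI[OF _ K(1,2)])
    show "Ck k (partial_deriv i \<phi>)" for k
      using test_function_Ck[OF assms, of "Suc k"] by simp
    show "partial_deriv i \<phi> x = 0" if "x \<notin> K" for x
      using partial_deriv_eq_0[OF compact_imp_closed] K that by blast
  qed
qed

lemma test_function_mult_Ck:
  assumes "\<phi> \<in> test_functions \<Omega>" "\<And>k. Ck k f"
  shows "(\<lambda>x. f x * \<phi> x) \<in> test_functions \<Omega>"
proof -
  obtain K where K: "compact K" "K \<subseteq> \<Omega>" "\<And>x. x \<notin> K \<Longrightarrow> \<phi> x = 0"
    using test_function_support[OF assms(1)] by metis
  then show ?thesis
    by (intro test_functionI[OF _ K(1,2)] Ck_mult assms(2) test_function_Ck[OF assms(1)]) auto
qed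

lemma test_function_add:
  assumes "\<phi> \<in> test_functions \<Omega>" "\<psi> \<in> test_functions \<Omega>"
  shows "(\<lambda>x. \<phi> x + \<psi> x) \<in> test_functions \<Omega>"
proof -
  obtain K L where "compact K" "K \<subseteq> \<Omega>" "\<And>x. x \<notin> K \<Longrightarrow> \<phi> x = 0"
    "compact L" "L \<subseteq> \<Omega>" "\<And>x. x \<notin> L \<Longrightarrow> \<psi> x = 0"
    using test_function_support[OF assms(1)] test_function_support[OF assms(2)] by metis
  then show ?thesis
    by (intro test_functionI[where K="K \<union> L"] Ck_add test_function_Ck[OF assms(1)]
        test_function_Ck[OF assms(2)] compact_Un) auto
qed

lemma test_function_zero: "(\<lambda>x. 0) \<in> test_functions \<Omega>"
  by (rule test_functionI[where K="{}"]) (auto intro: Ck_const)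

lemma test_function_sum:
  "finite I \<Longrightarrow> (\<And>i. i \<in> I \<Longrightarrow> f i \<in> test_functions \<Omega>) \<Longrightarrow> (\<lambda>x. \<Sum>i\<in>I. f i x) \<in> test_functions \<Omega>"
  by (induction I rule: finite_induct) (auto intro: test_function_zero test_function_add)

section \<open>Integrals of compactly supported functions\<close>

lemma integrable_compact_support:
  fixes f :: "'a::euclidean_space \<Rightarrow> real"
  assumes "continuous_on UNIV f" "compact K" "\<And>x. x \<notin> K \<Longrightarrow> f x = 0"
  shows "integrable lborel f"
proof -
  have "(\<lambda>x. indicator K x *\<^sub>R f x) = f"
    using assms(3) by (intro ext) (auto simp: indicator_def)
  then show ?thesis
    using borel_integrable_compact[OF assms(2) continuous_on_subset[OF assms(1)]] by simp
qed

text \<open>Moves integrals of functions that vanish off \<Omega> to the whole space, where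
  translation invariance is available.\<close>

lemma
  fixes f :: "real^'n::finite \<Rightarrow> real"
  assumes \<Omega>: "\<Omega> \<in> sets lebesgue" and f: "f \<in> borel_measurable borel" and "\<And>x. x \<notin> \<Omega> \<Longrightarrow> f x = 0"
  shows integrable_lebesgue_on_support: "integrable (lebesgue_on \<Omega>) f \<longleftrightarrow> integrable lborel f"
    and integral_lebesgue_on_support: "integral\<^sup>L (lebesgue_on \<Omega>) f = integral\<^sup>L lborel f"
proof -
  have "(\<lambda>x. indicator \<Omega> x *\<^sub>R f x) = f"
    using assms(3) by (intro ext) (auto simp: indicator_def)
  then show "integrable (lebesgue_on \<Omega>) f \<longleftrightarrow> integrable lborel f"
    and "integral\<^sup>L (lebesgue_on \<Omega>) f = integral\<^sup>L lborel f"
    using \<Omega> f by (simp_all add: integrable_restrict_space integral_restrict_space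
        integrable_completion integral_completion)
qed

lemma test_function_borel: "\<phi> \<in> test_functions \<Omega> \<Longrightarrow> \<phi> \<in> borel_measurable borel"
  using Ck_continuous[OF test_function_Ck[of \<phi> \<Omega> 0]] by (rule borel_measurable_continuous_onI)

lemma test_function_L2:
  assumes \<Omega>: "\<Omega> \<in> sets lebesgue" and \<phi>: "\<phi> \<in> test_functions \<Omega>"
  shows "\<phi> \<in> L2 \<Omega>"
proof -
  obtain K where K: "compact K" "K \<subseteq> \<Omega>" "\<And>x. x \<notin> K \<Longrightarrow> \<phi> x = 0"
    using test_function_support[OF \<phi>] by metis
  have "integrable lborel (\<lambda>x. (\<phi> x)\<^sup>2)"
    by (rule integrable_compact_support[OF _ K(1)])
      (use K Ck_continuous[OF test_function_Ck[OF \<phi>, of 0]] in \<open>auto intro!: continuous_intros\<close>)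
  then have "integrable (lebesgue_on \<Omega>) (\<lambda>x. (\<phi> x)\<^sup>2)"
    using test_function_borel[OF \<phi>] K by (subst integrable_lebesgue_on_support[OF \<Omega>]) auto
  moreover have "\<phi> \<in> borel_measurable (lebesgue_on \<Omega>)"
    using test_function_borel[OF \<phi>] by (intro measurable_restrict_space1) (simp add: measurable_completion)
  ultimately show ?thesis
    by (simp add: L2_def)
qed

lemma has_real_derivative_along_axis:
  assumes "f differentiable at (x + s *\<^sub>R axis i 1)"
  shows "((\<lambda>s. f (x + s *\<^sub>R axis i 1)) has_real_derivative partial_deriv i f (x + s *\<^sub>R axis i 1)) (at s)"
proof -
  let ?e = "axis i 1" and ?D = "frechet_derivative f (at (x + s *\<^sub>R axis i 1))"
  have D: "(f has_derivative ?D) (at (x + s *\<^sub>R ?e))"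
    using assms frechet_derivative_works by blast
  have "((\<lambda>s. x + s *\<^sub>R ?e) has_derivative (\<lambda>h. h *\<^sub>R ?e)) (at s)"
    by (auto intro!: derivative_eq_intros)
  from has_derivative_compose[OF this D]
  have "((\<lambda>s. f (x + s *\<^sub>R ?e)) has_derivative (\<lambda>h. ?D (h *\<^sub>R ?e))) (at s)" .
  moreover have "?D (h *\<^sub>R ?e) = partial_deriv i f (x + s *\<^sub>R ?e) * h" for h
    using linear_scale[OF has_derivative_linear[OF D], of h ?e] by (simp add: partial_deriv_def)
  ultimately show ?thesis
    by (simp add: has_field_derivative_def)
qed

subsection \<open>Integration by parts\<close>

text \<open>The integral of a difference quotient vanishes by translation invariance.\<close>

lemma integral_partial_deriv_eq_0:
  fixes f :: "real^'n::finite \<Rightarrow> real"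
  assumes f: "Ck 1 f" and K: "compact K" "\<And>x. x \<notin> K \<Longrightarrow> f x = 0"
  shows "integral\<^sup>L lborel (partial_deriv i f) = 0"
proof -
  let ?e = "axis i 1 :: real^'n"
  have diff: "f differentiable at x" for x
    using f by simp
  have contf: "continuous_on UNIV f"
    using f Ck_continuous by blast
  have contD: "continuous_on UNIV (partial_deriv i f)"
    using f by simp
  have D0: "partial_deriv i f x = 0" if "x \<notin> K" for x
    using partial_deriv_eq_0[OF compact_imp_closed] K that by blast
  have "bounded (partial_deriv i f ` K)"
    using contD K by (meson compact_continuous_image compact_imp_bounded continuous_on_subset subset_UNIV)
  then obtain B where B: "\<And>x. x \<in> K \<Longrightarrow> norm (partial_deriv i f x) \<le> B" "B > 0"
    by (auto simp: bounded_pos)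
  then have B: "\<bar>partial_deriv i f x\<bar> \<le> B" for x
    using D0[of x] by (cases "x \<in> K") auto
  obtain R where R: "\<And>x. x \<in> K \<Longrightarrow> norm x \<le> R"
    using compact_imp_bounded[OF K(1)] by (auto simp: bounded_iff)
  define t where "t n = inverse (real (Suc n))" for n
  have t: "0 < t n" "t n \<le> 1" for n
    by (auto simp: t_def inverse_le_1_iff)
  define s where "s n x = (f (x + t n *\<^sub>R ?e) - f x) / t n" for n x
  have fint: "integrable lborel f"
    by (rule integrable_compact_support[OF contf K])
  have shift: "integrable lborel (\<lambda>x. f (x + t n *\<^sub>R ?e))"
    "integral\<^sup>L lborel (\<lambda>x. f (x + t n *\<^sub>R ?e)) = integral\<^sup>L lborel f" for n
  proof -
    have "integrable (distr lborel borel ((+) (t n *\<^sub>R ?e))) f"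
      "integral\<^sup>L (distr lborel borel ((+) (t n *\<^sub>R ?e))) f = integral\<^sup>L lborel f"
      using fint by (simp_all add: lborel_distr_plus)
    then show "integrable lborel (\<lambda>x. f (x + t n *\<^sub>R ?e))"
      "integral\<^sup>L lborel (\<lambda>x. f (x + t n *\<^sub>R ?e)) = integral\<^sup>L lborel f"
      using borel_measurable_continuous_onI[OF contf]
      by (simp_all add: integrable_distr_eq integral_distr add.commute)
  qed
  have zero: "integral\<^sup>L lborel (s n) = 0" for n
    unfolding s_def using fint shift[of n] by simp
  have "(\<lambda>n. integral\<^sup>L lborel (s n)) \<longlonglongrightarrow> integral\<^sup>L lborel (partial_deriv i f)"
  \<comment> \<open>The support lies in the ball of radius R and the shifts have length at most 1,
    so all difference quotients vanish outside the ball of radius R + 1.\<close>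
  proof (rule integral_dominated_convergence[where w="\<lambda>x. B * indicator (cball 0 (R + 1)) x"])
    show "partial_deriv i f \<in> borel_measurable lborel"
      using borel_measurable_continuous_onI[OF contD] by simp
    show "s n \<in> borel_measurable lborel" for n
      unfolding s_def using fint shift(1)[of n] by (intro borel_measurable_divide borel_measurable_diff) auto
    show "integrable lborel (\<lambda>x. B * indicator (cball (0::real^'n) (R + 1)) x)"
      by (intro integrable_mult_right integrable_real_indicator emeasure_bounded_finite) auto
    have "(\<lambda>n. s n x) \<longlonglongrightarrow> partial_deriv i f x" for x
    proof -
      have d: "((\<lambda>h. (f (x + (0 + h) *\<^sub>R ?e) - f (x + 0 *\<^sub>R ?e)) / h) \<longlongrightarrow> partial_deriv i f (x + 0 *\<^sub>R ?e)) (at 0)"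
        using has_real_derivative_along_axis[OF diff, where x=x and s=0 and i=i] by (simp add: DERIV_def)
      have "t \<longlonglongrightarrow> 0"
        unfolding t_def by (rule LIMSEQ_inverse_real_of_nat)
      moreover have "t n \<noteq> 0" for n
        using t(1)[of n] by simp
      ultimately have "filterlim t (at 0) sequentially"
        by (simp add: filterlim_at)
      from filterlim_compose[OF d this] show ?thesis
        by (simp add: s_def)
    qed
    then show "AE x in lborel. (\<lambda>n. s n x) \<longlonglongrightarrow> partial_deriv i f x"
      by simp
    have "norm (s n x) \<le> B * indicator (cball 0 (R + 1)) x" for n x
    proof (cases "x \<in> cball 0 (R + 1)")
      case True
      \<comment> \<open>The mean value theorem bounds the quotient by the supremum B of the
        derivative.\<close>
      obtain z where "f (x + t n *\<^sub>R ?e) - f (x + 0 *\<^sub>R ?e) = (t n - 0) * partial_deriv i f (x + z *\<^sub>R ?e)"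
        using MVT2[OF t(1)[of n], of "\<lambda>s. f (x + s *\<^sub>R ?e)" "\<lambda>s. partial_deriv i f (x + s *\<^sub>R ?e)"]
          has_real_derivative_along_axis[OF diff] by blast
      then have "s n x = partial_deriv i f (x + z *\<^sub>R ?e)"
        using t(1)[of n] by (simp add: s_def)
      then show ?thesis
        using True B by simp
    next
      case False
      then have "norm x > R + 1" by simp
      moreover have "norm (x + t n *\<^sub>R ?e) \<ge> norm x - 1"
        using norm_triangle_ineq4[of "x + t n *\<^sub>R ?e" "t n *\<^sub>R ?e"] t[of n] by (simp add: norm_axis_1)
      ultimately have "x \<notin> K" "x + t n *\<^sub>R ?e \<notin> K"
        using R[of x] R[of "x + t n *\<^sub>R ?e"] by linarith+
      then show ?thesis
        using False K(2) by (simp add: s_def)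
    qed
    then show "AE x in lborel. norm (s n x) \<le> B * indicator (cball 0 (R + 1)) x" for n
      by simp
  qed
  then show ?thesis
    by (simp add: zero LIMSEQ_const_iff)
qed

text \<open>The product of the two functions has compact support in \<Omega>, so there is no
  boundary term, however irregular the boundary of \<Omega> is.\<close>

lemma integration_by_parts:
  assumes \<Omega>: "\<Omega> \<in> sets lebesgue" and \<phi>: "\<phi> \<in> test_functions \<Omega>" and \<psi>: "\<psi> \<in> test_functions \<Omega>"
  shows "L2_inner \<Omega> \<phi> (partial_deriv i \<psi>) = - L2_inner \<Omega> (partial_deriv i \<phi>) \<psi>"
proof -
  let ?f = "\<lambda>x. \<phi> x * \<psi> x"
  have f: "?f \<in> test_functions \<Omega>"
    using test_function_mult_Ck[OF \<psi> test_function_Ck[OF \<phi>]] .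
  obtain K where K: "compact K" "K \<subseteq> \<Omega>" "\<And>x. x \<notin> K \<Longrightarrow> ?f x = 0"
    using test_function_support[OF f] by metis
  note tests = \<phi> \<psi> test_function_partial_deriv[OF \<phi>, of i] test_function_partial_deriv[OF \<psi>, of i]
  note L2s = tests[THEN test_function_L2[OF \<Omega>]]
  have "partial_deriv i ?f = (\<lambda>x. \<phi> x * partial_deriv i \<psi> x + partial_deriv i \<phi> x * \<psi> x)"
    by (intro ext partial_deriv_mult test_function_differentiable[OF \<phi>] test_function_differentiable[OF \<psi>])
  moreover have "integral\<^sup>L (lebesgue_on \<Omega>) (partial_deriv i ?f) = 0"
  proof -
    have "partial_deriv i ?f x = 0" if "x \<notin> \<Omega>" for x
      by (rule partial_deriv_eq_0[OF compact_imp_closed[OF K(1)] K(3)]) (use K(2) that in auto)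
    then have "integral\<^sup>L (lebesgue_on \<Omega>) (partial_deriv i ?f) = integral\<^sup>L lborel (partial_deriv i ?f)"
      by (rule integral_lebesgue_on_support[OF \<Omega> test_function_borel[OF test_function_partial_deriv[OF f]]])
    also have "\<dots> = 0"
      by (rule integral_partial_deriv_eq_0[OF test_function_Ck[OF f] K(1)]) (rule K(3))
    finally show ?thesis .
  qed
  moreover have "integrable (lebesgue_on \<Omega>) (\<lambda>x. \<phi> x * partial_deriv i \<psi> x)"
    "integrable (lebesgue_on \<Omega>) (\<lambda>x. partial_deriv i \<phi> x * \<psi> x)"
    using L2_integrable_inner[OF L2s(1,4)] L2_integrable_inner[OF L2s(3,2)] by simp_all
  ultimately show ?thesis
    by (simp add: L2_inner_def)
qed

text \<open>Here \<delta> is half the width of the slab, whence the factor 2. A single partial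
  derivative controls p because its support is thin in that one direction.\<close>

lemma Poincare_slab:
  fixes p :: "real^'n::finite \<Rightarrow> real"
  assumes \<Omega>: "\<Omega> \<in> sets lebesgue" and p: "p \<in> test_functions \<Omega>"
    and slab: "\<And>x. p x \<noteq> 0 \<Longrightarrow> \<bar>x $ i - c\<bar> \<le> \<delta>" and \<delta>: "\<delta> \<ge> 0"
  shows "L2_norm \<Omega> p \<le> 2 * \<delta> * L2_norm \<Omega> (partial_deriv i p)"
proof -
  let ?y = "\<lambda>x::real^'n. x $ i + - c"
  let ?q = "\<lambda>x. ?y x * p x"
  have q: "?q \<in> test_functions \<Omega>"
    using test_function_mult_Ck[OF p Ck_coordinate] .
  note dp = test_function_partial_deriv[OF p, of i]
  note L2s = p[THEN test_function_L2[OF \<Omega>]] q[THEN test_function_L2[OF \<Omega>]] dp[THEN test_function_L2[OF \<Omega>]]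
  have dy: "?y differentiable at x" "partial_deriv i ?y x = 1" for x
    using partial_deriv_affine_comp[of "\<lambda>x. x" 1 1 x i "-c"] by auto
  have "partial_deriv i ?q = (\<lambda>x. ?y x * partial_deriv i p x + p x)"
    using partial_deriv_mult[OF dy(1) test_function_differentiable[OF p], of i] by (intro ext) (simp only: dy(2) mult_1_left)
  then have "L2_inner \<Omega> ?q (partial_deriv i p) = - L2_inner \<Omega> (\<lambda>x. ?y x * partial_deriv i p x + p x) p"
    using integration_by_parts[OF \<Omega> q p, of i] by simp
  \<comment> \<open>The product rule reproduces the inner product on the left with the opposite
    sign, so the two combine and isolate the norm of p.\<close>
  also have "\<dots> = - L2_inner \<Omega> ?q (partial_deriv i p) - (L2_norm \<Omega> p)\<^sup>2"
  proof -
    have "L2_inner \<Omega> (\<lambda>x. ?y x * partial_deriv i p x) p = L2_inner \<Omega> ?q (partial_deriv i p)"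
      by (simp add: L2_inner_def algebra_simps)
    moreover have "(\<lambda>x. ?y x * partial_deriv i p x) \<in> L2 \<Omega>"
      using test_function_L2[OF \<Omega> test_function_mult_Ck[OF dp Ck_coordinate]] .
    ultimately show ?thesis
      using L2s by (simp add: L2_inner_add_left L2_norm_square)
  qed
  finally have "(L2_norm \<Omega> p)\<^sup>2 = - 2 * L2_inner \<Omega> ?q (partial_deriv i p)"
    by simp
  also have "\<dots> \<le> 2 * (L2_norm \<Omega> ?q * L2_norm \<Omega> (partial_deriv i p))"
    using L2_Cauchy_Schwarz[OF L2s(2,3)] by linarith
  also have "\<dots> \<le> 2 * ((\<delta> * L2_norm \<Omega> p) * L2_norm \<Omega> (partial_deriv i p))"
  proof -
    have "(L2_norm \<Omega> ?q)\<^sup>2 \<le> (L2_norm \<Omega> (\<lambda>x. \<delta> * p x))\<^sup>2"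
    proof -
      have "(?q x)\<^sup>2 \<le> (\<delta> * p x)\<^sup>2" for x
        using slab[of x] \<delta> by (cases "p x = 0")
          (auto simp: power_mult_distrib abs_le_square_iff intro!: mult_right_mono simp flip: abs_le_square_iff)
      then show ?thesis
        using L2_integrable_square[OF L2s(2)] L2_integrable_square[OF L2_mult[OF L2s(1), of \<delta>]]
        by (auto simp: L2_norm_def intro!: integral_mono)
    qed
    then have "L2_norm \<Omega> ?q \<le> L2_norm \<Omega> (\<lambda>x. \<delta> * p x)"
      by (rule power2_le_imp_le) simp
    then show ?thesis
      using \<delta> by (simp add: L2_norm_mult mult_right_mono)
  qed
  finally have "L2_norm \<Omega> p * L2_norm \<Omega> p \<le> L2_norm \<Omega> p * (2 * \<delta> * L2_norm \<Omega> (partial_deriv i p))"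
    by (simp add: power2_eq_square mult_ac)
  then show ?thesis
    using \<delta> L2_norm_nonneg[of \<Omega> p] by (cases "L2_norm \<Omega> p = 0") (auto simp: mult_le_cancel_left)
qed

subsection \<open>The fundamental lemma of the calculus of variations\<close>

text \<open>The Borel sets over which f integrates to 0 form a Dynkin system, with
  \<open>tot\<close> providing complements and dominated convergence providing disjoint unions. Open
  boxes are closed under intersection and generate the Borel sets, so the system is
  everything.\<close>

lemma AE_zero_if_integral_boxes_zero:
  fixes f :: "'a::euclidean_space \<Rightarrow> real"
  assumes f: "integrable lborel f" and tot: "integral\<^sup>L lborel f = 0"
    and box: "\<And>c d. integral\<^sup>L lborel (\<lambda>x. f x * indicator (box c d) x) = 0"
  shows "AE x in lborel. f x = 0"
proof -
  note [measurable] = borel_measurable_integrable[OF f]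
  have int: "integrable lborel (\<lambda>x. f x * indicator A x)" if "A \<in> sets borel" for A
    using integrable_mult_indicator[of A lborel f] f that by (simp add: mult.commute)
  have zero: "integral\<^sup>L lborel (\<lambda>x. f x * indicator A x) = 0" if "A \<in> sets borel" for A
  proof -
    let ?G = "range (\<lambda>(a, b). box a b :: 'a set)"
    have borel: "sets borel = sigma_sets UNIV ?G"
      by (simp add: borel_eq_box)
    have "Int_stable ?G"
      by (auto simp: Int_stable_def box_Int_box)
    moreover have "?G \<subseteq> Pow UNIV"
      by simp
    ultimately show ?thesis
      using that unfolding borel
    proof (induction rule: sigma_sets_induct_disjoint)
      case (compl A)
      then have A: "A \<in> sets borel"
        by (simp add: borel)
      have "(\<lambda>x. f x * indicator (UNIV - A) x) = (\<lambda>x. f x - f x * indicator A x)"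
        by (auto simp: indicator_def)
      then show ?case
        using f int[OF A] compl(2) tot by simp
    next
      case (union A)
      then have A: "A i \<in> sets borel" for i
        by (auto simp: borel)
      have sums: "(\<lambda>n. f x * indicator (\<Union>i<n. A i) x) \<longlonglongrightarrow> f x * indicator (\<Union>i. A i) x" for x
        by (intro tendsto_intros LIMSEQ_indicator_UN)
      have part: "integral\<^sup>L lborel (\<lambda>x. f x * indicator (\<Union>i<n. A i) x) = 0" for n
      proof -
        have "indicator (\<Union>i<n. A i) x = (\<Sum>i<n. indicator (A i) x :: real)" for x
          using union(1) by (intro indicator_UN_disjoint) (auto simp: disjoint_family_on_def)
        then have eq: "(\<lambda>x. f x * indicator (\<Union>i<n. A i) x) = (\<lambda>x. \<Sum>i<n. f x * indicator (A i) x)"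
          by (simp only: sum_distrib_left)
        show ?thesis
          unfolding eq using int[OF A] union(3) by (subst Bochner_Integration.integral_sum) auto
      qed
      have "(\<lambda>n. integral\<^sup>L lborel (\<lambda>x. f x * indicator (\<Union>i<n. A i) x))
          \<longlonglongrightarrow> integral\<^sup>L lborel (\<lambda>x. f x * indicator (\<Union>i. A i) x)"
        using A sums f
        by (intro integral_dominated_convergence[where w="\<lambda>x. norm (f x)"])
          (auto simp: indicator_def intro!: AE_I2)
      then show ?case
        by (simp add: part LIMSEQ_const_iff)
    qed (auto simp: box)
  qed
  \<comment> \<open>On its positivity and on its negativity set f has a constant sign, so a
    vanishing integral forces it to vanish there.\<close>
  have "AE x in lborel. f x * indicator {x. 0 < f x} x = 0"
    using zero[of "{x. 0 < f x}"] int[of "{x. 0 < f x}"]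
    by (subst integral_nonneg_eq_0_iff_AE[symmetric]) (auto simp: indicator_def)
  moreover have "AE x in lborel. - (f x * indicator {x. f x < 0} x) = 0"
    using zero[of "{x. f x < 0}"] int[of "{x. f x < 0}"]
    by (subst integral_nonneg_eq_0_iff_AE[symmetric]) (auto simp: indicator_def)
  ultimately show ?thesis
    by eventually_elim (auto simp: indicator_def split: if_splits)
qed

text \<open>Plateau functions carry the orthogonality over to indicators of boxes whose closed box
  lies in \<Omega>. Inside one such box the Dynkin argument applies, and countably many closed boxes
  exhaust \<Omega>.\<close>

lemma L2_test_orthogonal_imp_AE_0:
  fixes g :: "real^'n::finite \<Rightarrow> real"
  assumes \<Omega>: "open \<Omega>" and g: "g \<in> L2 \<Omega>"
    and orth: "\<And>\<phi>. \<phi> \<in> test_functions \<Omega> \<Longrightarrow> L2_inner \<Omega> g \<phi> = 0"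
  shows "AE x in lebesgue_on \<Omega>. g x = 0"
proof -
  let ?M = "lebesgue_on \<Omega>"
  have \<Omega>s: "\<Omega> \<in> sets lebesgue"
    using \<Omega> by (intro sets_completionI_sets) (simp add: borel_open)
  note [measurable] = L2_measurable[OF g]
  have gB: "(\<lambda>x. g x * indicator B x) \<in> borel_measurable ?M" if "B \<in> sets borel" for B
    using that by (intro borel_measurable_times L2_measurable[OF g] measurable_restrict_space1 measurable_completion) simp
  have ind: "(indicator (cbox a b) :: _ \<Rightarrow> real) \<in> L2 \<Omega>" for a b :: "real^'n"
  proof -
    have "integrable lborel (indicator (cbox a b) :: _ \<Rightarrow> real)"
      by (intro integrable_real_indicator emeasure_bounded_finite) auto
    then have "integrable lebesgue (indicator (cbox a b) :: _ \<Rightarrow> real)"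
      by (simp add: integrable_completion)
    then have "integrable lebesgue (\<lambda>x. indicator \<Omega> x *\<^sub>R indicator (cbox a b) x :: real)"
      using \<Omega>s by (intro integrable_mult_indicator) auto
    then have "integrable ?M (indicator (cbox a b) :: _ \<Rightarrow> real)"
      using \<Omega>s by (simp add: integrable_restrict_space)
    moreover have "(\<lambda>x. (norm (indicator (cbox a b) x :: real))\<^sup>2) = indicator (cbox a b)"
      by (auto simp: indicator_def)
    ultimately show ?thesis
      by (simp add: L2_def borel_measurable_integrable)
  qed
  \<comment> \<open>The dominating function: g is square integrable and so integrable over bounded
    boxes, though possibly not over \<Omega>.\<close>
  have int: "integrable ?M (\<lambda>x. \<bar>g x\<bar> * indicator (cbox a b) x)" for a b
    using integrable_norm[OF L2_integrable_inner[OF g ind[of a b]]] by (simp add: abs_mult)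
  have bz: "(LINT x|?M. g x * indicator (box a b) x) = 0" if ab: "cbox a b \<subseteq> \<Omega>" for a b
  proof -
    let ?\<phi> = "\<lambda>n x. 1 - (1 - box_bump a b x) ^ n"
    have bounds: "0 \<le> ?\<phi> n x" "?\<phi> n x \<le> indicator (cbox a b) x" for n x
    proof -
      have "x \<notin> cbox a b \<Longrightarrow> box_bump a b x = 0"
        using box_bump_eq_0 box_subset_cbox by blast
      then show "0 \<le> ?\<phi> n x" "?\<phi> n x \<le> indicator (cbox a b) x"
        using box_bump_nonneg[of a b x] box_bump_le_1[of a b x]
        by (cases "x \<in> cbox a b"; simp add: power_le_one)+
    qed
    have [measurable]: "?\<phi> n \<in> borel_measurable ?M" for n
      by (rule L2_measurable[OF test_function_L2[OF \<Omega>s test_function_box_plateau[OF ab]]])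
    have "(\<lambda>n. ?\<phi> n x) \<longlonglongrightarrow> indicator (box a b) x" for x
    proof (cases "x \<in> box a b")
      case True
      have "(\<lambda>n. (1 - box_bump a b x) ^ n) \<longlonglongrightarrow> 0"
        using box_bump_pos[OF True] box_bump_le_1[of a b x] by (intro LIMSEQ_power_zero) auto
      then show ?thesis
        using tendsto_diff[OF tendsto_const, of _ 0 sequentially 1] True by fastforce
    qed (simp add: box_bump_eq_0)
    then have "(\<lambda>n. LINT x|?M. g x * ?\<phi> n x) \<longlonglongrightarrow> (LINT x|?M. g x * indicator (box a b) x)"
      using int[of a b] bounds gB[of "box a b"]
      by (intro integral_dominated_convergence[where w="\<lambda>x. \<bar>g x\<bar> * indicator (cbox a b) x"])
        (auto simp: abs_mult intro!: AE_I2 mult_left_mono tendsto_mult)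
    moreover have "(LINT x|?M. g x * ?\<phi> n x) = 0" for n
      using orth[OF test_function_box_plateau[OF ab, of n]] by (simp add: L2_inner_def)
    ultimately show ?thesis
      by (simp add: LIMSEQ_const_iff)
  qed
  have box0: "AE x in lebesgue. x \<in> box a b \<longrightarrow> g x = 0" if ab: "cbox a b \<subseteq> \<Omega>" for a b
  proof -
    let ?F = "\<lambda>x. indicator \<Omega> x * (g x * indicator (box a b) x)"
    have "integrable ?M (\<lambda>x. g x * indicator (box a b) x)"
      using box_subset_cbox[of a b] gB[of "box a b"]
      by (intro Bochner_Integration.integrable_bound[OF int[of a b]]) (auto simp: indicator_def)
    then have Fint: "integrable lebesgue ?F"
      using \<Omega>s by (simp add: integrable_restrict_space)
    \<comment> \<open>The Dynkin argument takes place in \<open>lborel\<close>, whereas g is only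
      Lebesgue measurable; h is a Borel version of g cut off to the box.\<close>
    obtain h where h: "h \<in> borel_measurable lborel" and eq: "AE x in lborel. ?F x = h x"
      using completion_ex_borel_measurable_real[of ?F lborel] borel_measurable_integrable[OF Fint] by blast
    note eq' = AE_completion[OF eq]
    have hm: "h \<in> borel_measurable lebesgue"
      using h by (simp add: measurable_completion)
    have "integrable lebesgue h"
      using eq' by (intro integrable_cong_AE_imp[OF Fint hm]) (auto elim: AE_mp)
    then have hint: "integrable lborel h"
      using h by (simp add: integrable_completion)
    have hA: "integral\<^sup>L lborel (\<lambda>x. h x * indicator A x) = (LINT x|?M. g x * indicator (box a b \<inter> A) x)"
      if A: "A \<in> sets borel" for A
    proof -
      have "integral\<^sup>L lborel (\<lambda>x. h x * indicator A x) = integral\<^sup>L lebesgue (\<lambda>x. h x * indicator A x)"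
        using h A by (intro integral_completion[symmetric]) simp
      also have "\<dots> = integral\<^sup>L lebesgue (\<lambda>x. ?F x * indicator A x)"
      proof (rule integral_cong_AE)
        have A: "(indicator A :: _ \<Rightarrow> real) \<in> borel_measurable lebesgue"
          using A by (intro borel_measurable_indicator) simp
        show "(\<lambda>x. h x * indicator A x) \<in> borel_measurable lebesgue"
          by (rule borel_measurable_times[OF hm A])
        show "(\<lambda>x. ?F x * indicator A x) \<in> borel_measurable lebesgue"
          by (rule borel_measurable_times[OF borel_measurable_integrable[OF Fint] A])
        show "AE x in lebesgue. h x * indicator A x = ?F x * indicator A x"
          using eq' by eventually_elim simp
      qed
      also have "\<dots> = (LINT x|?M. g x * indicator (box a b \<inter> A) x)"
        using \<Omega>s by (simp add: integral_restrict_space indicator_inter_arith mult_ac)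
      finally show ?thesis .
    qed
    have "AE x in lborel. h x = 0"
    proof (rule AE_zero_if_integral_boxes_zero[OF hint])
      show "integral\<^sup>L lborel h = 0"
        using hA[of UNIV] bz[OF ab] by simp
      fix c d
      obtain a' b' where eq: "box a b \<inter> box c d = box a' b'"
        by (rule that[OF box_Int_box])
      show "integral\<^sup>L lborel (\<lambda>x. h x * indicator (box c d) x) = 0"
      \<comment> \<open>If the open box is nonempty, its closed box is its closure and hence stays
        inside \<Omega>. If it is empty, the closed box may be degenerate and leave \<Omega>, but
        the integral is then over the empty set.\<close>
      proof (cases "box a' b' = {}")
        case False
        have "cbox a' b' \<subseteq> closure (box a b)"
          unfolding closure_box[OF False, symmetric] eq[symmetric] by (rule closure_mono) simp
        also have "\<dots> \<subseteq> \<Omega>"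
          using ab closure_minimal[OF box_subset_cbox closed_cbox, of a b] by simp
        finally show ?thesis
          using hA[of "box c d"] bz eq by simp
      qed (use hA[of "box c d"] eq in simp)
    qed
    then have "AE x in lebesgue. h x = 0"
      by (rule AE_completion)
    with eq' show ?thesis
    proof eventually_elim
      case (elim x)
      then show ?case
        using ab box_subset_cbox[of a b] by (auto simp: indicator_def split: if_splits)
    qed
  qed
  have cbox0: "AE x in lebesgue. x \<in> cbox a b \<longrightarrow> g x = 0" if ab: "cbox a b \<subseteq> \<Omega>" for a b
  proof -
    have "AE x in lebesgue. x \<notin> cbox a b - box a b"
      using negligible_frontier_interval[of a b] by (intro AE_not_in) (simp add: negligible_iff_null_sets)
    with box0[OF ab] show ?thesis
      by eventually_elim auto
  qed
  obtain D where D: "countable D" "D \<subseteq> Pow \<Omega>" "\<And>X. X \<in> D \<Longrightarrow> \<exists>a b. X = cbox a b" "\<Union>D = \<Omega>"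
    using open_countable_Union_open_cbox[OF \<Omega>] by metis
  have "AE x in lebesgue. \<forall>X\<in>D. x \<in> X \<longrightarrow> g x = 0"
    using D cbox0 by (subst AE_ball_countable) (auto, metis PowD subsetD)
  then have "AE x in lebesgue. x \<in> \<Omega> \<longrightarrow> g x = 0"
    using D(4) by (auto elim!: eventually_mono)
  then show ?thesis
    using \<Omega>s by (simp add: AE_restrict_space_iff)
qed

subsection \<open>Closed operators between \<open>L\<^sup>2\<close> spaces\<close>

lemma L2_Pair_iff:
  fixes w :: "real^'n::finite \<Rightarrow> 'a::euclidean_space" and g :: "real^'n \<Rightarrow> 'b::euclidean_space"
  shows "(\<lambda>x. (w x, g x)) \<in> L2 \<Omega> \<longleftrightarrow> w \<in> L2 \<Omega> \<and> g \<in> L2 \<Omega>"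
proof
  assume L: "(\<lambda>x. (w x, g x)) \<in> L2 \<Omega>"
  let ?M = "lebesgue_on \<Omega>"
  note m = L2_measurable[OF L] and i = L2_integrable_square[OF L]
  have "(\<lambda>x. fst (w x, g x)) \<in> borel_measurable ?M" "(\<lambda>x. snd (w x, g x)) \<in> borel_measurable ?M"
    using measurable_compose[OF m borel_measurable_continuous_onI]
    by (blast intro: continuous_on_fst continuous_on_snd continuous_on_id)+
  then have [measurable]: "w \<in> borel_measurable ?M" "g \<in> borel_measurable ?M"
    by simp_all
  have "integrable ?M (\<lambda>x. (norm (w x))\<^sup>2)" "integrable ?M (\<lambda>x. (norm (g x))\<^sup>2)"
    by (rule Bochner_Integration.integrable_bound[OF i]; simp add: norm_Pair)+
  then show "w \<in> L2 \<Omega> \<and> g \<in> L2 \<Omega>"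
    by (simp add: L2_def)
next
  assume "w \<in> L2 \<Omega> \<and> g \<in> L2 \<Omega>"
  then show "(\<lambda>x. (w x, g x)) \<in> L2 \<Omega>"
    by (simp add: L2_def norm_Pair borel_measurable_Pair)
qed

lemma L2_fst: "z \<in> L2 \<Omega> \<Longrightarrow> (\<lambda>x. fst (z x)) \<in> L2 \<Omega>"
  and L2_snd: "z \<in> L2 \<Omega> \<Longrightarrow> (\<lambda>x. snd (z x)) \<in> L2 \<Omega>"
  using L2_Pair_iff[of "\<lambda>x. fst (z x)" "\<lambda>x. snd (z x)"] by simp_all

lemma L2_inner_Pair:
  assumes "z \<in> L2 \<Omega>" "y \<in> L2 \<Omega>"
  shows "L2_inner \<Omega> z y = L2_inner \<Omega> (\<lambda>x. fst (z x)) (\<lambda>x. fst (y x)) + L2_inner \<Omega> (\<lambda>x. snd (z x)) (\<lambda>x. snd (y x))"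
  using L2_integrable_inner[OF L2_fst[OF assms(1)] L2_fst[OF assms(2)]]
    L2_integrable_inner[OF L2_snd[OF assms(1)] L2_snd[OF assms(2)]]
  by (simp add: L2_inner_def inner_prod_def)

lemma L2_norm_fst_le: "z \<in> L2 \<Omega> \<Longrightarrow> L2_norm \<Omega> (\<lambda>x. fst (z x)) \<le> L2_norm \<Omega> z"
  and L2_norm_snd_le: "z \<in> L2 \<Omega> \<Longrightarrow> L2_norm \<Omega> (\<lambda>x. snd (z x)) \<le> L2_norm \<Omega> z"
  using L2_inner_Pair[of z \<Omega> z] L2_norm_nonneg
  by (auto intro!: power2_le_imp_le[OF _ L2_norm_nonneg] simp flip: L2_norm_square)

lemma L2_inner_eq_0_if_norm_eq_0:
  assumes "f \<in> L2 \<Omega>" "g \<in> L2 \<Omega>" "L2_norm \<Omega> f = 0"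
  shows "L2_inner \<Omega> f g = 0"
  using L2_Cauchy_Schwarz[OF assms(1,2)] assms(3) by simp

lemma L2_add_scaleR: "f \<in> L2 \<Omega> \<Longrightarrow> g \<in> L2 \<Omega> \<Longrightarrow> (\<lambda>x. f x + c *\<^sub>R g x) \<in> L2 \<Omega>"
  by (intro L2_add L2_scaleR)

lemma L2_inner_add_scaleR_left:
  "f \<in> L2 \<Omega> \<Longrightarrow> g \<in> L2 \<Omega> \<Longrightarrow> h \<in> L2 \<Omega> \<Longrightarrow>
    L2_inner \<Omega> (\<lambda>x. f x + c *\<^sub>R g x) h = L2_inner \<Omega> f h + c * L2_inner \<Omega> g h"
  by (simp add: L2_inner_add_left L2_scaleR L2_inner_scaleR_left)

text \<open>The orthogonal complement of K, closed under \<open>L2\<close> limits whatever K is;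
  closedness of weak derivatives is thereby immediate.\<close>

definition L2_annihilator ::
  "(real^'n::finite) set \<Rightarrow> (real^'n \<Rightarrow> 'a::euclidean_space) set \<Rightarrow> (real^'n \<Rightarrow> 'a) set" where
  "L2_annihilator \<Omega> K = {z \<in> L2 \<Omega>. \<forall>k\<in>K. L2_inner \<Omega> z k = 0}"

lemma L2_annihilator_add_scaleR:
  "K \<subseteq> L2 \<Omega> \<Longrightarrow> f \<in> L2_annihilator \<Omega> K \<Longrightarrow> g \<in> L2_annihilator \<Omega> K \<Longrightarrow>
    (\<lambda>x. f x + c *\<^sub>R g x) \<in> L2_annihilator \<Omega> K"
  by (auto simp: L2_annihilator_def L2_add_scaleR L2_inner_add_scaleR_left subset_iff)

lemma L2_annihilator_zero: "(\<lambda>x. 0) \<in> L2_annihilator \<Omega> K"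
  by (simp add: L2_annihilator_def L2_zero L2_inner_def)

lemma L2_annihilator_closed:
  assumes "K \<subseteq> L2 \<Omega>" "\<And>n. f n \<in> L2_annihilator \<Omega> K" "w \<in> L2 \<Omega>"
    and "(\<lambda>n. L2_norm \<Omega> (\<lambda>x. f n x - w x)) \<longlonglongrightarrow> 0"
  shows "w \<in> L2_annihilator \<Omega> K"
proof -
  have "L2_inner \<Omega> w k = 0" if "k \<in> K" for k
  proof -
    have "(\<lambda>n. L2_inner \<Omega> (f n) k) \<longlonglongrightarrow> L2_inner \<Omega> w k"
      by (rule L2_inner_tendsto) (use assms that in \<open>auto simp: L2_annihilator_def\<close>)
    moreover have "L2_inner \<Omega> (f n) k = 0" for n
      using assms(2)[of n] that by (simp add: L2_annihilator_def)
    ultimately show ?thesis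
      by (simp add: LIMSEQ_const_iff)
  qed
  with assms(3) show ?thesis
    by (simp add: L2_annihilator_def)
qed

lemma L2_annihilator_projection:
  assumes \<Omega>: "\<Omega> \<in> sets lebesgue" and K: "K \<subseteq> L2 \<Omega>" and u: "u \<in> L2 \<Omega>"
  obtains w where "w \<in> L2_annihilator \<Omega> K"
    "\<And>g. g \<in> L2_annihilator \<Omega> K \<Longrightarrow> L2_inner \<Omega> (\<lambda>x. u x - w x) g = 0"
proof -
  have N: "L2_annihilator \<Omega> K \<subseteq> L2 \<Omega>" "L2_annihilator \<Omega> K \<noteq> {}"
    using L2_annihilator_zero by (auto simp: L2_annihilator_def)
  obtain w f where w: "w \<in> L2 \<Omega>" "\<And>n::nat. f n \<in> L2_annihilator \<Omega> K"
    "(\<lambda>n. L2_norm \<Omega> (\<lambda>x. f n x - w x)) \<longlonglongrightarrow> 0"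
    and orth: "\<And>g. g \<in> L2_annihilator \<Omega> K \<Longrightarrow> L2_inner \<Omega> (\<lambda>x. u x - w x) g = 0"
    by (rule L2_projection[OF \<Omega> u N L2_annihilator_add_scaleR[OF K]]) (assumption | rule that)+
  show thesis
    by (rule that[OF L2_annihilator_closed[OF K w(2,1,3)] orth])
qed

text \<open>
  A closed operator from one \<open>L\<^sup>2\<close> space to another, given by testing: its graph consists of the
  pairs orthogonal to a set of test pairs. The last two assumptions say that the values are unique
  up to equality almost everywhere and that the domain is dense.
\<close>

locale weak_derivative =
  fixes \<Omega> :: "(real^'n::finite) set"
    and rel :: "(real^'n \<Rightarrow> 'a::euclidean_space) \<Rightarrow> (real^'n \<Rightarrow> 'b::euclidean_space) \<Rightarrow> bool"
    and K :: "(real^'n \<Rightarrow> 'a \<times> 'b) set"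
  assumes \<Omega>: "\<Omega> \<in> sets lebesgue"
    and K: "K \<subseteq> L2 \<Omega>"
    and rel_iff: "\<And>w g. w \<in> L2 \<Omega> \<Longrightarrow> g \<in> L2 \<Omega> \<Longrightarrow>
      rel w g \<longleftrightarrow> (\<lambda>x. (w x, g x)) \<in> L2_annihilator \<Omega> K"
    and snd_orth: "\<And>g. g \<in> L2 \<Omega> \<Longrightarrow> (\<And>k. k \<in> K \<Longrightarrow> L2_inner \<Omega> g (\<lambda>x. snd (k x)) = 0) \<Longrightarrow> L2_norm \<Omega> g = 0"
    and dom_orth: "\<And>u. u \<in> L2 \<Omega> \<Longrightarrow>
      (\<And>w g. w \<in> L2 \<Omega> \<Longrightarrow> g \<in> L2 \<Omega> \<Longrightarrow> rel w g \<Longrightarrow> L2_inner \<Omega> u w = 0) \<Longrightarrow> L2_norm \<Omega> u = 0"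
begin

definition dom :: "(real^'n \<Rightarrow> 'a) set" where
  "dom = {w \<in> L2 \<Omega>. \<exists>g\<in>L2 \<Omega>. rel w g}"

text \<open>The same choice expression as in \<open>weak_grad\<close> and \<open>weak_div\<close>,
  so that these become instances by unfolding definitions.\<close>

definition der :: "(real^'n \<Rightarrow> 'a) \<Rightarrow> real^'n \<Rightarrow> 'b" where
  "der w = (SOME g. g \<in> L2 \<Omega> \<and> rel w g)"

abbreviation graph :: "(real^'n \<Rightarrow> 'a \<times> 'b) set" where
  "graph \<equiv> L2_annihilator \<Omega> K"

lemma domI: "w \<in> L2 \<Omega> \<Longrightarrow> g \<in> L2 \<Omega> \<Longrightarrow> rel w g \<Longrightarrow> w \<in> dom"
  by (auto simp: dom_def)

lemma dom_L2: "w \<in> dom \<Longrightarrow> w \<in> L2 \<Omega>"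
  by (simp add: dom_def)

lemma
  assumes "w \<in> dom"
  shows der_L2: "der w \<in> L2 \<Omega>" and rel_der: "rel w (der w)"
proof -
  have "\<exists>g. g \<in> L2 \<Omega> \<and> rel w g"
    using assms by (auto simp: dom_def)
  then have "der w \<in> L2 \<Omega> \<and> rel w (der w)"
    unfolding der_def by (rule someI_ex)
  then show "der w \<in> L2 \<Omega>" "rel w (der w)"
    by blast+
qed

lemma graph_L2: "z \<in> graph \<Longrightarrow> z \<in> L2 \<Omega>"
  by (simp add: L2_annihilator_def)

lemma rel_add_scaleR:
  assumes "w \<in> L2 \<Omega>" "g \<in> L2 \<Omega>" "rel w g" "v \<in> L2 \<Omega>" "h \<in> L2 \<Omega>" "rel v h"
  shows "rel (\<lambda>x. w x + c *\<^sub>R v x) (\<lambda>x. g x + c *\<^sub>R h x)"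
  using L2_annihilator_add_scaleR[OF K, of "\<lambda>x. (w x, g x)" "\<lambda>x. (v x, h x)" c] assms
  by (simp add: rel_iff L2_add_scaleR)

lemma dom_add_scaleR:
  assumes "w \<in> dom" "v \<in> dom"
  shows "(\<lambda>x. w x + c *\<^sub>R v x) \<in> dom"
proof (rule domI)
  show "(\<lambda>x. w x + c *\<^sub>R v x) \<in> L2 \<Omega>" "(\<lambda>x. der w x + c *\<^sub>R der v x) \<in> L2 \<Omega>"
    using assms by (simp_all add: L2_add_scaleR dom_L2 der_L2)
  show "rel (\<lambda>x. w x + c *\<^sub>R v x) (\<lambda>x. der w x + c *\<^sub>R der v x)"
    using assms by (intro rel_add_scaleR dom_L2 der_L2 rel_der)
qed

lemma zero_rel: "rel (\<lambda>x. 0) (\<lambda>x. 0)"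
  using L2_annihilator_zero[of \<Omega> K] by (simp add: rel_iff L2_zero zero_prod_def)

lemma zero_dom: "(\<lambda>x. 0) \<in> dom"
  by (rule domI[OF L2_zero L2_zero zero_rel])

lemma dom_scaleR: "w \<in> dom \<Longrightarrow> (\<lambda>x. c *\<^sub>R w x) \<in> dom"
  using dom_add_scaleR[OF zero_dom, of w c] by simp

lemma rel_scaleR:
  assumes "w \<in> L2 \<Omega>" "g \<in> L2 \<Omega>" "rel w g"
  shows "rel (\<lambda>x. c *\<^sub>R w x) (\<lambda>x. c *\<^sub>R g x)"
  using rel_add_scaleR[OF L2_zero L2_zero zero_rel assms, of c] by simp

lemma rel_cong_AE:
  assumes "w \<in> L2 \<Omega>" "g \<in> L2 \<Omega>" "rel w g" "v \<in> L2 \<Omega>" "AE x in lebesgue_on \<Omega>. w x = v x"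
  shows "rel v g"
proof -
  have P: "(\<lambda>x. (w x, g x)) \<in> L2 \<Omega>" "(\<lambda>x. (v x, g x)) \<in> L2 \<Omega>"
    using assms by (simp_all add: L2_Pair_iff)
  have ae: "AE x in lebesgue_on \<Omega>. (w x, g x) = (v x, g x)"
    using assms(5) by eventually_elim simp
  have "L2_inner \<Omega> (\<lambda>x. (v x, g x)) k = 0" if k: "k \<in> K" for k
  proof -
    have "L2_inner \<Omega> (\<lambda>x. (w x, g x)) k = L2_inner \<Omega> (\<lambda>x. (v x, g x)) k"
      using L2_inner_cong_AE[OF P _ ae] k K by blast
    with assms k show ?thesis
      by (simp add: rel_iff L2_annihilator_def)
  qed
  with P show ?thesis
    using assms by (simp add: rel_iff L2_annihilator_def)
qed

lemma dom_cong_AE: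
  "w \<in> dom \<Longrightarrow> v \<in> L2 \<Omega> \<Longrightarrow> AE x in lebesgue_on \<Omega>. w x = v x \<Longrightarrow> v \<in> dom"
  by (rule domI[OF _ der_L2 rel_cong_AE[OF dom_L2 der_L2 rel_der]])

text \<open>The difference of two graph elements over w is (0, g - h). Its orthogonality to K
  involves only the second components of the test pairs, to which \<open>snd_orth\<close>
  applies.\<close>

lemma rel_unique:
  assumes "w \<in> L2 \<Omega>" "g \<in> L2 \<Omega>" "h \<in> L2 \<Omega>" "rel w g" "rel w h"
  shows "AE x in lebesgue_on \<Omega>. g x = h x"
proof -
  have "rel (\<lambda>x. w x + (-1) *\<^sub>R w x) (\<lambda>x. g x + (-1) *\<^sub>R h x)"
    using assms by (intro rel_add_scaleR)
  then have Z: "(\<lambda>x. (0, g x - h x)) \<in> graph"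
    using assms by (simp add: rel_iff L2_zero L2_diff)
  have L: "(\<lambda>x. g x - h x) \<in> L2 \<Omega>"
    using assms by (simp add: L2_diff)
  have "L2_norm \<Omega> (\<lambda>x. g x - h x) = 0"
  proof (rule snd_orth[OF L])
    fix k assume k: "k \<in> K"
    then have "L2_inner \<Omega> (\<lambda>x. (0, g x - h x)) k = 0"
      using Z by (simp add: L2_annihilator_def)
    moreover have "L2_inner \<Omega> (\<lambda>x. 0) (\<lambda>x. fst (k x)) = 0"
      by (simp add: L2_inner_def)
    ultimately show "L2_inner \<Omega> (\<lambda>x. g x - h x) (\<lambda>x. snd (k x)) = 0"
      using L2_inner_Pair[OF graph_L2[OF Z], of k] k K by auto
  qed
  then show ?thesis
    by (simp add: L2_norm_eq_0_iff[OF L])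
qed

lemma der_unique:
  assumes "w \<in> L2 \<Omega>" "g \<in> L2 \<Omega>" "rel w g"
  shows "AE x in lebesgue_on \<Omega>. der w x = g x"
  using assms domI[OF assms] by (intro rel_unique[of w] der_L2 rel_der)

lemma L2_norm_der:
  assumes "w \<in> L2 \<Omega>" "g \<in> L2 \<Omega>" "rel w g"
  shows "L2_norm \<Omega> (der w) = L2_norm \<Omega> g"
  using L2_norm_cong_AE[OF der_L2[OF domI[OF assms]] assms(2) der_unique[OF assms]] .

lemma L2_norm_der_zero: "L2_norm \<Omega> (der (\<lambda>x. 0)) = 0"
  using L2_norm_der[OF L2_zero L2_zero zero_rel] by (simp add: L2_norm_def)

lemma L2_norm_der_diff:
  assumes "w \<in> dom" "v \<in> dom"
  shows "L2_norm \<Omega> (der (\<lambda>x. w x - v x)) = L2_norm \<Omega> (\<lambda>x. der w x - der v x)"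
proof (rule L2_norm_der)
  have "rel (\<lambda>x. w x + (-1) *\<^sub>R v x) (\<lambda>x. der w x + (-1) *\<^sub>R der v x)"
    using assms by (intro rel_add_scaleR dom_L2 der_L2 rel_der)
  then show "rel (\<lambda>x. w x - v x) (\<lambda>x. der w x - der v x)"
    by simp
qed (use assms in \<open>simp_all add: L2_diff dom_L2 der_L2\<close>)

text \<open>The residual of the projection onto the closure of \<open>dom\<close> is orthogonal to
  \<open>dom\<close>, hence null by \<open>dom_orth\<close>; the approximants are then taken from
  the minimizing sequence.\<close>

lemma dom_dense:
  assumes u: "u \<in> L2 \<Omega>" and e: "e > 0"
  shows "\<exists>w\<in>dom. L2_norm \<Omega> (\<lambda>x. u x - w x) < e"
proof -
  have D: "dom \<subseteq> L2 \<Omega>" "dom \<noteq> {}"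
    using zero_dom by (auto simp: dom_def)
  obtain w f where w: "w \<in> L2 \<Omega>" and f: "\<And>n::nat. f n \<in> dom"
    and lim: "(\<lambda>n. L2_norm \<Omega> (\<lambda>x. f n x - w x)) \<longlonglongrightarrow> 0"
    and orth: "\<And>g. g \<in> dom \<Longrightarrow> L2_inner \<Omega> (\<lambda>x. u x - w x) g = 0"
    by (rule L2_projection[OF \<Omega> u D dom_add_scaleR]) (assumption | rule that)+
  have "L2_norm \<Omega> (\<lambda>x. u x - w x) = 0"
    using L2_diff[OF u w] by (rule dom_orth) (blast intro: orth domI)
  moreover obtain n where "L2_norm \<Omega> (\<lambda>x. f n x - w x) < e"
    using LIMSEQ_D[OF lim e] by auto
  ultimately have "L2_norm \<Omega> (\<lambda>x. u x - f n x) < e"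
    using L2_norm_triangle_diff[OF u w dom_L2[OF f], of n] by (simp add: L2_norm_diff_commute)
  with f show ?thesis by blast
qed

text \<open>
  This is von Neumann's theorem that the domain of \<open>T\<^sup>*T\<close> is a core of the closed operator \<open>T\<close>: an
  element \<open>r\<close> of the graph orthogonal to it vanishes, because \<open>1 + T\<^sup>*T\<close> is onto. The preimage of
  \<open>fst r\<close> is the first component of the orthogonal projection of \<open>(fst r, 0)\<close> onto the graph.
\<close>

lemma core:
  assumes u: "u \<in> dom" and e: "e > 0"
  obtains w f where "w \<in> dom" "f \<in> L2 \<Omega>"
    "\<And>v k. v \<in> L2 \<Omega> \<Longrightarrow> k \<in> L2 \<Omega> \<Longrightarrow> rel v k \<Longrightarrow> L2_inner \<Omega> (der w) k = L2_inner \<Omega> f v"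
    "L2_norm \<Omega> (\<lambda>x. u x - w x) < e" "L2_norm \<Omega> (\<lambda>x. der u x - der w x) < e"
proof -
  \<comment> \<open>\<open>adj y f\<close> says that \<open>snd y\<close> lies in the domain of the
    adjoint of T, with value f. For y in the graph this reads T*T (fst y) = f, so \<open>D\<close>
    is the graph of T over the domain of T*T.\<close>
  define adj where "adj y f \<longleftrightarrow> f \<in> L2 \<Omega> \<and> (\<forall>v\<in>graph.
    L2_inner \<Omega> (\<lambda>x. snd (y x)) (\<lambda>x. snd (v x)) = L2_inner \<Omega> f (\<lambda>x. fst (v x)))" for y :: "real^'n \<Rightarrow> 'a \<times> 'b" and f
  define D where "D = {y \<in> graph. \<exists>f. adj y f}"
  let ?z = "\<lambda>x. (u x, der u x)"
  have z: "?z \<in> graph"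
    using rel_iff[OF dom_L2[OF u] der_L2[OF u]] rel_der[OF u] by simp
  have DL: "D \<subseteq> L2 \<Omega>"
    by (auto simp: D_def intro: graph_L2)
  have D_ne: "D \<noteq> {}"
  proof -
    have "adj (\<lambda>x. 0) (\<lambda>x. 0)"
      by (simp add: adj_def L2_zero L2_inner_def)
    then show ?thesis
      using L2_annihilator_zero[of \<Omega> K] by (auto simp: D_def)
  qed
  have D_lin: "(\<lambda>x. y x + c *\<^sub>R y' x) \<in> D" if yD: "y \<in> D" "y' \<in> D" for y y' c
  proof -
    obtain f f' where y: "y \<in> graph" "y' \<in> graph" "adj y f" "adj y' f'"
      using yD by (auto simp: D_def)
    then have "adj (\<lambda>x. y x + c *\<^sub>R y' x) (\<lambda>x. f x + c *\<^sub>R f' x)"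
      by (simp add: adj_def L2_add_scaleR L2_inner_add_scaleR_left L2_fst L2_snd graph_L2)
    then show ?thesis
      using y L2_annihilator_add_scaleR[OF K] by (auto simp: D_def)
  qed
  obtain w f where w: "w \<in> L2 \<Omega>" and f: "\<And>n::nat. f n \<in> D"
    and lim: "(\<lambda>n. L2_norm \<Omega> (\<lambda>x. f n x - w x)) \<longlonglongrightarrow> 0"
    and orth: "\<And>g. g \<in> D \<Longrightarrow> L2_inner \<Omega> (\<lambda>x. ?z x - w x) g = 0"
    by (rule L2_projection[OF \<Omega> graph_L2[OF z] DL D_ne D_lin]) (assumption | rule that)+
  have wg: "w \<in> graph"
    by (rule L2_annihilator_closed[OF K _ w lim]) (use f in \<open>auto simp: D_def\<close>)
  define r where "r x = ?z x - w x" for x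
  have r: "r \<in> graph"
    using L2_annihilator_add_scaleR[OF K z wg, of "-1"] by (simp add: r_def[abs_def])
  let ?e = "\<lambda>x. fst (r x)"
  have eL: "?e \<in> L2 \<Omega>"
    using r by (intro L2_fst graph_L2)
  have e_L2: "(\<lambda>x. (?e x, 0)) \<in> L2 \<Omega>"
    using eL L2_zero by (simp add: L2_Pair_iff)
  obtain y where y: "y \<in> graph"
    and yorth: "\<And>g. g \<in> graph \<Longrightarrow> L2_inner \<Omega> (\<lambda>x. (?e x, 0) - y x) g = 0"
    by (rule L2_annihilator_projection[OF \<Omega> K e_L2]) (assumption | rule that)+
  note yL = L2_fst[OF graph_L2[OF y]] L2_snd[OF graph_L2[OF y]]
  \<comment> \<open>Orthogonality of (e, 0) - y to the graph, with e the first component of r, is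
    the weak form of T*T (fst y) = e - fst y: the equation (1 + T*T) (fst y) = e is solved.\<close>
  have adj_y: "adj y (\<lambda>x. ?e x - fst (y x))"
    unfolding adj_def
  proof (intro conjI ballI)
    show "(\<lambda>x. ?e x - fst (y x)) \<in> L2 \<Omega>"
      by (intro L2_diff eL yL)
    fix v assume v: "v \<in> graph"
    have "(\<lambda>x. (?e x, 0) - y x) \<in> L2 \<Omega>"
      using eL L2_zero graph_L2[OF y] by (intro L2_diff) (simp add: L2_Pair_iff)
    from L2_inner_Pair[OF this graph_L2[OF v]] yorth[OF v]
    show "L2_inner \<Omega> (\<lambda>x. snd (y x)) (\<lambda>x. snd (v x)) = L2_inner \<Omega> (\<lambda>x. ?e x - fst (y x)) (\<lambda>x. fst (v x))"
      by (simp add: L2_inner_minus_left)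
  qed
  then have "y \<in> D"
    using y by (auto simp: D_def)
  then have "L2_inner \<Omega> r y = 0"
    using orth[of y] by (simp add: r_def[abs_def])
  \<comment> \<open>Testing \<open>adj_y\<close> with r itself rewrites the second summand; the two
    terms with \<open>fst y\<close> cancel and the squared norm of e is left, while r is orthogonal
    to y.\<close>
  moreover have "L2_inner \<Omega> r y = L2_inner \<Omega> ?e (\<lambda>x. fst (y x)) + L2_inner \<Omega> (\<lambda>x. ?e x - fst (y x)) ?e"
    using L2_inner_Pair[OF graph_L2[OF r] graph_L2[OF y]] adj_y r
    by (simp add: adj_def L2_inner_commute[of \<Omega> "\<lambda>x. snd (r x)"])
  ultimately have "(L2_norm \<Omega> ?e)\<^sup>2 = 0"
    using L2_inner_diff_left[OF eL yL(1) eL] by (simp add: L2_norm_square L2_inner_commute[of \<Omega> ?e "\<lambda>x. fst (y x)"])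
  then have e0: "L2_norm \<Omega> ?e = 0"
    by simp
  \<comment> \<open>r lies in the graph over a null function, so its value is null too, by the
    argument that gives uniqueness.\<close>
  have "L2_norm \<Omega> (\<lambda>x. snd (r x)) = 0"
  proof (rule snd_orth[OF L2_snd[OF graph_L2[OF r]]])
    fix k assume k: "k \<in> K"
    then have "k \<in> L2 \<Omega>" "L2_inner \<Omega> r k = 0"
      using r K by (auto simp: L2_annihilator_def)
    then show "L2_inner \<Omega> (\<lambda>x. snd (r x)) (\<lambda>x. snd (k x)) = 0"
      using L2_inner_Pair[OF graph_L2[OF r]] L2_inner_eq_0_if_norm_eq_0[OF eL L2_fst e0] by force
  qed
  with e0 have r0: "L2_norm \<Omega> r = 0"
    using L2_inner_Pair[OF graph_L2[OF r] graph_L2[OF r]] by (simp flip: L2_norm_square)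
  obtain n where n: "L2_norm \<Omega> (\<lambda>x. f n x - w x) < e"
    using LIMSEQ_D[OF lim e] by auto
  have fn: "f n \<in> graph"
    using f by (simp add: D_def)
  let ?d = "\<lambda>x. ?z x - f n x"
  have dL: "?d \<in> L2 \<Omega>"
    by (intro L2_diff graph_L2 z fn)
  have d: "L2_norm \<Omega> ?d < e"
    using L2_norm_triangle_diff[OF graph_L2[OF z] w graph_L2[OF fn]] n r0
    by (simp add: L2_norm_diff_commute r_def[abs_def])
  let ?w = "\<lambda>x. fst (f n x)" and ?g = "\<lambda>x. snd (f n x)"
  have wL: "?w \<in> L2 \<Omega>" and gL: "?g \<in> L2 \<Omega>"
    using fn by (auto intro: L2_fst L2_snd graph_L2)
  have rel: "rel ?w ?g"
    using fn rel_iff[OF wL gL] by simp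
  note ae = der_unique[OF wL gL rel]
  note wdom = domI[OF wL gL rel]
  obtain h where h: "adj (f n) h"
    using f[of n] by (auto simp: D_def)
  show thesis
  proof (rule that[of ?w h])
    show "L2_norm \<Omega> (\<lambda>x. u x - ?w x) < e"
      using L2_norm_fst_le[OF dL] d by simp
    have "L2_norm \<Omega> (\<lambda>x. der u x - der ?w x) = L2_norm \<Omega> (\<lambda>x. der u x - ?g x)"
      using ae by (intro L2_norm_cong_AE L2_diff der_L2 u wdom gL) auto
    then show "L2_norm \<Omega> (\<lambda>x. der u x - der ?w x) < e"
      using L2_norm_snd_le[OF dL] d by simp
    show "L2_inner \<Omega> (der ?w) k = L2_inner \<Omega> h v" if "v \<in> L2 \<Omega>" "k \<in> L2 \<Omega>" "rel v k" for v k
    proof -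
      have "L2_inner \<Omega> (der ?w) k = L2_inner \<Omega> ?g k"
        by (rule L2_inner_cong_AE[OF der_L2[OF wdom] gL that(2) ae])
      also have "\<dots> = L2_inner \<Omega> h v"
        using h rel_iff[OF that(1,2)] that(3) by (force simp: adj_def)
      finally show ?thesis .
    qed
  qed (use wdom h in \<open>auto simp: adj_def\<close>)
qed

end

subsection \<open>Weak gradient and weak divergence\<close>

definition classical_grad :: "(real^'n::finite \<Rightarrow> real) \<Rightarrow> real^'n \<Rightarrow> real^'n" where
  "classical_grad \<phi> x = (\<chi> i. partial_deriv i \<phi> x)"

definition classical_div :: "(real^'n::finite \<Rightarrow> real^'n) \<Rightarrow> real^'n \<Rightarrow> real" where
  "classical_div v x = (\<Sum>i\<in>UNIV. partial_deriv i (\<lambda>x. v x $ i) x)"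

definition test_fields :: "(real^'n::finite) set \<Rightarrow> (real^'n \<Rightarrow> real^'n) set" where
  "test_fields \<Omega> = {v. \<forall>i. (\<lambda>x. v x $ i) \<in> test_functions \<Omega>}"

lemma test_field_component: "v \<in> test_fields \<Omega> \<Longrightarrow> (\<lambda>x. v x $ i) \<in> test_functions \<Omega>"
  by (simp add: test_fields_def)

text \<open>The bridge between scalar and vector tests: the divergence of this field is the i-th
  partial derivative of \<phi>.\<close>

lemma test_field_axis: "\<phi> \<in> test_functions \<Omega> \<Longrightarrow> (\<lambda>x. \<phi> x *\<^sub>R axis i 1) \<in> test_fields \<Omega>"
  by (auto simp: test_fields_def axis_def test_function_zero)

lemma classical_div_axis: "classical_div (\<lambda>x. \<phi> x *\<^sub>R axis i 1) = partial_deriv i \<phi>"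
proof
  fix x
  have "partial_deriv j (\<lambda>x. (\<phi> x *\<^sub>R axis i 1) $ j) x = (if j = i then partial_deriv i \<phi> x else 0)" for j
    by (auto simp: axis_def partial_deriv_def)
  then show "classical_div (\<lambda>x. \<phi> x *\<^sub>R axis i 1) x = partial_deriv i \<phi> x"
    by (simp add: classical_div_def)
qed

lemma test_field_classical_grad: "\<phi> \<in> test_functions \<Omega> \<Longrightarrow> classical_grad \<phi> \<in> test_fields \<Omega>"
  by (simp add: test_fields_def classical_grad_def test_function_partial_deriv)

lemma test_function_classical_div: "v \<in> test_fields \<Omega> \<Longrightarrow> classical_div v \<in> test_functions \<Omega>"
  unfolding classical_div_def[abs_def]
  by (intro test_function_sum test_function_partial_deriv) (auto simp: test_fields_def)

lemma L2_vec_component: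
  fixes v :: "real^'n::finite \<Rightarrow> real^'m::finite"
  assumes "v \<in> L2 \<Omega>"
  shows "(\<lambda>x. v x $ i) \<in> L2 \<Omega>"
proof -
  have m: "(\<lambda>x. v x $ i) \<in> borel_measurable (lebesgue_on \<Omega>)"
    using borel_measurable_continuous_on[OF _ L2_measurable[OF assms], of "\<lambda>y. y $ i"]
    by (simp add: continuous_intros)
  have "integrable (lebesgue_on \<Omega>) (\<lambda>x. (v x $ i)\<^sup>2)"
  proof (rule Bochner_Integration.integrable_bound[OF L2_integrable_square[OF assms]])
    have "(v x $ i)\<^sup>2 \<le> (norm (v x))\<^sup>2" for x
      using component_le_norm_cart[of "v x" i] by (simp add: abs_le_square_iff[symmetric])
    then show "AE x in lebesgue_on \<Omega>. norm ((v x $ i)\<^sup>2) \<le> norm ((norm (v x))\<^sup>2)"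
      by simp
  qed (use m in simp)
  with m show ?thesis
    by (simp add: L2_def)
qed

lemma L2_sum: "finite I \<Longrightarrow> (\<And>i. i \<in> I \<Longrightarrow> f i \<in> L2 \<Omega>) \<Longrightarrow> (\<lambda>x. \<Sum>i\<in>I. f i x) \<in> L2 \<Omega>"
  by (induction I rule: finite_induct) (auto intro: L2_add L2_zero)

lemma L2_vecI:
  fixes v :: "real^'n::finite \<Rightarrow> real^'m::finite"
  assumes "\<And>i. (\<lambda>x. v x $ i) \<in> L2 \<Omega>"
  shows "v \<in> L2 \<Omega>"
proof -
  have "(\<lambda>x. v x $ i *\<^sub>R axis i 1 :: real^'m) \<in> L2 \<Omega>" for i
    using assms[of i] by (auto simp: L2_def norm_axis_1 intro!: borel_measurable_scaleR)
  then have "(\<lambda>x. \<Sum>i\<in>UNIV. v x $ i *\<^sub>R axis i 1 :: real^'m) \<in> L2 \<Omega>"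
    by (intro L2_sum) auto
  then show ?thesis
    using basis_expansion[of "v x" for x] by (simp add: scalar_mult_eq_scaleR)
qed

lemma test_field_L2: "\<Omega> \<in> sets lebesgue \<Longrightarrow> v \<in> test_fields \<Omega> \<Longrightarrow> v \<in> L2 \<Omega>"
  by (intro L2_vecI test_function_L2 test_field_component)

lemma L2_inner_vec:
  fixes v w :: "real^'n::finite \<Rightarrow> real^'m::finite"
  assumes "v \<in> L2 \<Omega>" "w \<in> L2 \<Omega>"
  shows "L2_inner \<Omega> v w = (\<Sum>i\<in>UNIV. L2_inner \<Omega> (\<lambda>x. v x $ i) (\<lambda>x. w x $ i))"
  using L2_integrable_inner[OF L2_vec_component[OF assms(1)] L2_vec_component[OF assms(2)]]
  by (simp add: L2_inner_def inner_vec_def)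

lemma has_weak_grad_iff:
  "has_weak_grad \<Omega> p g \<longleftrightarrow> (\<forall>\<phi>\<in>test_functions \<Omega>. \<forall>i.
    L2_inner \<Omega> p (partial_deriv i \<phi>) = - L2_inner \<Omega> g (\<lambda>x. \<phi> x *\<^sub>R axis i 1))"
  by (simp add: has_weak_grad_def L2_inner_def inner_axis mult.commute)

lemma has_weak_div_iff:
  "has_weak_div \<Omega> q g \<longleftrightarrow> (\<forall>\<phi>\<in>test_functions \<Omega>.
    L2_inner \<Omega> q (classical_grad \<phi>) = - L2_inner \<Omega> g \<phi>)"
  by (simp add: has_weak_div_def L2_inner_def inner_vec_def classical_grad_def)

lemma has_weak_grad_classical:
  assumes \<Omega>: "\<Omega> \<in> sets lebesgue" and p: "p \<in> test_functions \<Omega>"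
  shows "has_weak_grad \<Omega> p (classical_grad p)"
  using integration_by_parts[OF \<Omega> p] unfolding has_weak_grad_iff
  by (simp add: L2_inner_def inner_axis classical_grad_def mult.commute)

lemma has_weak_div_classical:
  assumes \<Omega>: "\<Omega> \<in> sets lebesgue" and v: "v \<in> test_fields \<Omega>"
  shows "has_weak_div \<Omega> v (classical_div v)"
  unfolding has_weak_div_iff
proof
  fix \<phi> assume \<phi>: "\<phi> \<in> test_functions \<Omega>"
  let ?v = "\<lambda>i x. v x $ i"
  have "L2_inner \<Omega> v (classical_grad \<phi>) = (\<Sum>i\<in>UNIV. L2_inner \<Omega> (?v i) (partial_deriv i \<phi>))"
    using test_field_L2[OF \<Omega> v] test_field_L2[OF \<Omega> test_field_classical_grad[OF \<phi>]]
    by (simp add: L2_inner_vec) (simp add: classical_grad_def)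
  also have "\<dots> = - (\<Sum>i\<in>UNIV. L2_inner \<Omega> (partial_deriv i (?v i)) \<phi>)"
    using integration_by_parts[OF \<Omega> test_field_component[OF v] \<phi>] by (simp add: sum_negf)
  also have "(\<Sum>i\<in>UNIV. L2_inner \<Omega> (partial_deriv i (?v i)) \<phi>) = L2_inner \<Omega> (classical_div v) \<phi>"
    using L2_integrable_inner[OF test_function_L2[OF \<Omega> test_function_partial_deriv[OF test_field_component[OF v]]]
        test_function_L2[OF \<Omega> \<phi>]]
    by (simp add: L2_inner_def classical_div_def sum_distrib_right)
  finally show "L2_inner \<Omega> v (classical_grad \<phi>) = - L2_inner \<Omega> (classical_div v) \<phi>" .
qed

lemma L2_test_orthogonal_imp_norm_0:
  fixes g :: "real^'n::finite \<Rightarrow> real"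
  assumes "open \<Omega>" "g \<in> L2 \<Omega>" "\<And>\<phi>. \<phi> \<in> test_functions \<Omega> \<Longrightarrow> L2_inner \<Omega> g \<phi> = 0"
  shows "L2_norm \<Omega> g = 0"
  using L2_test_orthogonal_imp_AE_0[OF assms] L2_norm_eq_0_iff[OF assms(2)] by simp

lemma L2_test_field_orthogonal_imp_norm_0:
  fixes g :: "real^'n::finite \<Rightarrow> real^'n"
  assumes \<Omega>: "open \<Omega>" and g: "g \<in> L2 \<Omega>"
    and orth: "\<And>\<phi> i. \<phi> \<in> test_functions \<Omega> \<Longrightarrow> L2_inner \<Omega> g (\<lambda>x. \<phi> x *\<^sub>R axis i 1) = 0"
  shows "L2_norm \<Omega> g = 0"
proof -
  have "AE x in lebesgue_on \<Omega>. g x $ i = 0" for i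
  proof (rule L2_test_orthogonal_imp_AE_0[OF \<Omega> L2_vec_component[OF g]])
    show "L2_inner \<Omega> (\<lambda>x. g x $ i) \<phi> = 0" if "\<phi> \<in> test_functions \<Omega>" for \<phi>
      using orth[OF that, of i] by (simp add: L2_inner_def inner_axis mult.commute)
  qed
  then have "AE x in lebesgue_on \<Omega>. \<forall>i. g x $ i = 0"
    by (simp add: AE_all_countable)
  then have "AE x in lebesgue_on \<Omega>. g x = 0"
    by eventually_elim (simp add: vec_eq_iff)
  then show ?thesis
    by (simp add: L2_norm_eq_0_iff[OF g])
qed

lemma open_imp_lebesgue: "open \<Omega> \<Longrightarrow> \<Omega> \<in> sets lebesgue"
  by (intro sets_completionI_sets) (simp add: borel_open)

section \<open>Gradient and divergence as closed operators\<close>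

text \<open>The minus sign of integration by parts is absorbed: the identity for a weak gradient g
  of p becomes orthogonality of (p, g) to these pairs.\<close>

definition grad_tests :: "(real^'n::finite) set \<Rightarrow> (real^'n \<Rightarrow> real \<times> (real^'n)) set" where
  "grad_tests \<Omega> = (\<Union>i. (\<lambda>\<phi> x. (partial_deriv i \<phi> x, \<phi> x *\<^sub>R axis i 1)) ` test_functions \<Omega>)"

definition div_tests :: "(real^'n::finite) set \<Rightarrow> (real^'n \<Rightarrow> (real^'n) \<times> real) set" where
  "div_tests \<Omega> = (\<lambda>\<phi> x. (classical_grad \<phi> x, \<phi> x)) ` test_functions \<Omega>"

lemma grad_testsI:
  "\<phi> \<in> test_functions \<Omega> \<Longrightarrow> (\<lambda>x. (partial_deriv i \<phi> x, \<phi> x *\<^sub>R axis i 1)) \<in> grad_tests \<Omega>"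
  by (auto simp: grad_tests_def)

lemma div_testsI: "\<phi> \<in> test_functions \<Omega> \<Longrightarrow> (\<lambda>x. (classical_grad \<phi> x, \<phi> x)) \<in> div_tests \<Omega>"
  by (auto simp: div_tests_def)

text \<open>Both orthogonality conditions are instances of the fundamental lemma: for values it is
  applied componentwise, and for the domain it applies because test functions belong to it with
  their classical gradients.\<close>

lemma weak_derivative_grad:
  assumes "open \<Omega>"
  shows "weak_derivative \<Omega> (has_weak_grad \<Omega>) (grad_tests \<Omega>)"
proof
  show \<Omega>: "\<Omega> \<in> sets lebesgue"
    by (rule open_imp_lebesgue[OF assms])
  show K: "grad_tests \<Omega> \<subseteq> L2 \<Omega>"
    by (auto simp: grad_tests_def L2_Pair_iff test_function_L2[OF \<Omega>] test_field_L2[OF \<Omega>]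
        test_function_partial_deriv test_field_axis)
  show "has_weak_grad \<Omega> w g \<longleftrightarrow> (\<lambda>x. (w x, g x)) \<in> L2_annihilator \<Omega> (grad_tests \<Omega>)"
    if wg: "w \<in> L2 \<Omega>" "g \<in> L2 \<Omega>" for w g
  proof -
    have P: "(\<lambda>x. (w x, g x)) \<in> L2 \<Omega>"
      using wg by (simp add: L2_Pair_iff)
    have "L2_inner \<Omega> (\<lambda>x. (w x, g x)) (\<lambda>x. (partial_deriv i \<phi> x, \<phi> x *\<^sub>R axis i 1)) =
        L2_inner \<Omega> w (partial_deriv i \<phi>) + L2_inner \<Omega> g (\<lambda>x. \<phi> x *\<^sub>R axis i 1)"
      if "\<phi> \<in> test_functions \<Omega>" for \<phi> i
      using L2_inner_Pair[OF P subsetD[OF K grad_testsI[OF that, of i]]] by simp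
    then show ?thesis
      using P unfolding has_weak_grad_iff L2_annihilator_def grad_tests_def
      by (auto simp: eq_neg_iff_add_eq_0)
  qed
  show "L2_norm \<Omega> g = 0"
    if g: "g \<in> L2 \<Omega>" and orth: "\<And>k. k \<in> grad_tests \<Omega> \<Longrightarrow> L2_inner \<Omega> g (\<lambda>x. snd (k x)) = 0" for g
  proof (rule L2_test_field_orthogonal_imp_norm_0[OF assms g])
    show "L2_inner \<Omega> g (\<lambda>x. \<phi> x *\<^sub>R axis i 1) = 0" if "\<phi> \<in> test_functions \<Omega>" for \<phi> i
      using orth[OF grad_testsI[OF that, of i]] by simp
  qed
  show "L2_norm \<Omega> u = 0"
    if u: "u \<in> L2 \<Omega>" and orth: "\<And>w g. w \<in> L2 \<Omega> \<Longrightarrow> g \<in> L2 \<Omega> \<Longrightarrow> has_weak_grad \<Omega> w g \<Longrightarrow> L2_inner \<Omega> u w = 0"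
    for u
    by (rule L2_test_orthogonal_imp_norm_0[OF assms u])
      (rule orth[OF test_function_L2[OF \<Omega>] test_field_L2[OF \<Omega> test_field_classical_grad] has_weak_grad_classical[OF \<Omega>]])
qed

lemma weak_derivative_div:
  assumes "open \<Omega>"
  shows "weak_derivative \<Omega> (has_weak_div \<Omega>) (div_tests \<Omega>)"
proof
  show \<Omega>: "\<Omega> \<in> sets lebesgue"
    by (rule open_imp_lebesgue[OF assms])
  show K: "div_tests \<Omega> \<subseteq> L2 \<Omega>"
    by (auto simp: div_tests_def L2_Pair_iff test_function_L2[OF \<Omega>] test_field_L2[OF \<Omega>]
        test_field_classical_grad)
  show "has_weak_div \<Omega> w g \<longleftrightarrow> (\<lambda>x. (w x, g x)) \<in> L2_annihilator \<Omega> (div_tests \<Omega>)"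
    if wg: "w \<in> L2 \<Omega>" "g \<in> L2 \<Omega>" for w g
  proof -
    have P: "(\<lambda>x. (w x, g x)) \<in> L2 \<Omega>"
      using wg by (simp add: L2_Pair_iff)
    have "L2_inner \<Omega> (\<lambda>x. (w x, g x)) (\<lambda>x. (classical_grad \<phi> x, \<phi> x)) =
        L2_inner \<Omega> w (classical_grad \<phi>) + L2_inner \<Omega> g \<phi>"
      if "\<phi> \<in> test_functions \<Omega>" for \<phi>
      using L2_inner_Pair[OF P subsetD[OF K div_testsI[OF that]]] by simp
    then show ?thesis
      using P unfolding has_weak_div_iff L2_annihilator_def div_tests_def
      by (auto simp: eq_neg_iff_add_eq_0)
  qed
  show "L2_norm \<Omega> g = 0"
    if g: "g \<in> L2 \<Omega>" and orth: "\<And>k. k \<in> div_tests \<Omega> \<Longrightarrow> L2_inner \<Omega> g (\<lambda>x. snd (k x)) = 0" for g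
  proof (rule L2_test_orthogonal_imp_norm_0[OF assms g])
    show "L2_inner \<Omega> g \<phi> = 0" if "\<phi> \<in> test_functions \<Omega>" for \<phi>
      using orth[OF div_testsI[OF that]] by simp
  qed
  show "L2_norm \<Omega> u = 0"
    if u: "u \<in> L2 \<Omega>" and orth: "\<And>w g. w \<in> L2 \<Omega> \<Longrightarrow> g \<in> L2 \<Omega> \<Longrightarrow> has_weak_div \<Omega> w g \<Longrightarrow> L2_inner \<Omega> u w = 0"
    for u
    by (rule L2_test_field_orthogonal_imp_norm_0[OF assms u])
      (rule orth[OF test_field_L2[OF \<Omega> test_field_axis]
        test_function_L2[OF \<Omega> test_function_classical_div[OF test_field_axis]]
        has_weak_div_classical[OF \<Omega> test_field_axis]])
qed

subsection \<open>Unboundedness\<close>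

lemma L2_norm_component_le:
  fixes v :: "real^'n::finite \<Rightarrow> real^'m::finite"
  assumes "v \<in> L2 \<Omega>"
  shows "L2_norm \<Omega> (\<lambda>x. v x $ i) \<le> L2_norm \<Omega> v"
proof -
  have "(v x $ i)\<^sup>2 \<le> (norm (v x))\<^sup>2" for x
    using component_le_norm_cart[of "v x" i] by (simp add: abs_le_square_iff[symmetric])
  then show ?thesis
    using L2_integrable_square[OF assms] L2_integrable_square[OF L2_vec_component[OF assms, of i]]
    by (simp add: L2_norm_def integral_mono)
qed

lemma box_bump_norm_pos:
  assumes \<Omega>: "\<Omega> \<in> sets lebesgue" and ab: "cbox a b \<subseteq> \<Omega>" "box a b \<noteq> {}" and L: "box_bump a b \<in> L2 \<Omega>"
  shows "0 < L2_norm \<Omega> (box_bump a b)"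
proof (rule ccontr)
  assume "\<not> ?thesis"
  then have "L2_norm \<Omega> (box_bump a b) = 0"
    using L2_norm_nonneg[of \<Omega> "box_bump a b"] by simp
  then have "AE x in lebesgue_on \<Omega>. box_bump a b x = 0"
    using L2_norm_eq_0_iff[OF L] by simp
  then have "AE x in lebesgue. x \<in> \<Omega> \<longrightarrow> box_bump a b x = 0"
    using \<Omega> by (simp add: AE_restrict_space_iff)
  then have "AE x in lebesgue. x \<notin> box a b"
  proof eventually_elim
    case (elim x)
    then show ?case
      using box_bump_pos[of x a b] ab(1) box_subset_cbox[of a b] by force
  qed
  then have "negligible (box a b)"
    by (simp add: negligible_iff_null_sets AE_iff_null_sets[of _ lebesgue])
  then show False
    using open_not_negligible[of "box a b"] ab(2) by blast
qed

text \<open>A bump on a box inside the ball of radius \<delta> / 2 around a point of \<Omega>: this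
  half-width makes the Poincare constant exactly \<delta>.\<close>

lemma concentrated_test_function:
  assumes \<Omega>: "open \<Omega>" "\<Omega> \<noteq> {}" and \<delta>: "\<delta> > 0"
  obtains p where "p \<in> test_functions \<Omega>" "0 < L2_norm \<Omega> p"
    "L2_norm \<Omega> p \<le> \<delta> * L2_norm \<Omega> (classical_grad p)"
proof -
  note \<Omega>s = open_imp_lebesgue[OF \<Omega>(1)]
  obtain x0 where x0: "x0 \<in> \<Omega>"
    using \<Omega> by blast
  have "open (\<Omega> \<inter> ball x0 (\<delta> / 2))" "x0 \<in> \<Omega> \<inter> ball x0 (\<delta> / 2)"
    using \<Omega>(1) \<delta> x0 by auto
  then obtain a b where ab: "x0 \<in> box a b" "cbox a b \<subseteq> \<Omega> \<inter> ball x0 (\<delta> / 2)"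
    using open_contains_cbox by metis
  let ?p = "box_bump a b"
  have p: "?p \<in> test_functions \<Omega>"
    using test_function_box_plateau[of a b \<Omega> 1] ab(2) by simp
  have "\<bar>x $ i - x0 $ i\<bar> \<le> \<delta> / 2" if "?p x \<noteq> 0" for x i
  proof -
    have "x \<in> cbox a b"
      using that box_bump_eq_0[of x a b] box_subset_cbox[of a b] by blast
    then have "norm (x - x0) < \<delta> / 2"
      using ab(2) by (auto simp: dist_norm norm_minus_commute)
    then show ?thesis
      using component_le_norm_cart[of "x - x0" i] by simp
  qed
  then have "L2_norm \<Omega> ?p \<le> 2 * (\<delta> / 2) * L2_norm \<Omega> (partial_deriv i ?p)" for i
    using \<delta> by (intro Poincare_slab[OF \<Omega>s p]) auto
  \<comment> \<open>Any coordinate direction will do; \<open>undefined\<close> names one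
    index.\<close>
  from this[of undefined]
  have "L2_norm \<Omega> ?p \<le> \<delta> * L2_norm \<Omega> (partial_deriv undefined ?p)"
    by simp
  also have "\<dots> \<le> \<delta> * L2_norm \<Omega> (classical_grad ?p)"
    using L2_norm_component_le[OF test_field_L2[OF \<Omega>s test_field_classical_grad[OF p]], of undefined] \<delta>
    by (simp add: classical_grad_def)
  finally have le: "L2_norm \<Omega> ?p \<le> \<delta> * L2_norm \<Omega> (classical_grad ?p)" .
  have "0 < L2_norm \<Omega> ?p"
    by (rule box_bump_norm_pos[OF \<Omega>s _ _ test_function_L2[OF \<Omega>s p]]) (use ab in auto)
  from that[OF p this le] show thesis .
qed

lemma classical_grad_norm_le_laplacian:
  assumes \<Omega>: "\<Omega> \<in> sets lebesgue" and p: "p \<in> test_functions \<Omega>"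
  shows "(L2_norm \<Omega> (classical_grad p))\<^sup>2 \<le> L2_norm \<Omega> (classical_div (classical_grad p)) * L2_norm \<Omega> p"
proof -
  note g = test_field_classical_grad[OF p]
  have "(L2_norm \<Omega> (classical_grad p))\<^sup>2 = - L2_inner \<Omega> (classical_div (classical_grad p)) p"
    using has_weak_div_classical[OF \<Omega> g] p unfolding has_weak_div_iff L2_norm_square by blast
  also have "\<dots> \<le> L2_norm \<Omega> (classical_div (classical_grad p)) * L2_norm \<Omega> p"
    using L2_Cauchy_Schwarz[OF test_function_L2[OF \<Omega> test_function_classical_div[OF g]] test_function_L2[OF \<Omega> p]]
    by linarith
  finally show ?thesis .
qed

text \<open>A zero parameter would send a state carrying p in the matching slot to the same image as
  the zero state. The witness p has positive norm, so the failure is not merely one of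
  representatives.\<close>

lemma op_H_inj_imp_nonzero:
  fixes \<Omega> :: "(real^'n::finite) set"
  assumes \<Omega>: "open \<Omega>" "\<Omega> \<noteq> {}" and inj: "inj_on (op_H \<rho> \<eta>) (L2_state \<Omega>)"
  shows "\<rho> \<noteq> 0" "\<eta> \<noteq> 0"
proof -
  note \<Omega>s = open_imp_lebesgue[OF \<Omega>(1)]
  obtain p where p: "p \<in> test_functions \<Omega>" "0 < L2_norm \<Omega> p"
    using concentrated_test_function[OF \<Omega>, of 1] by auto
  have "p \<noteq> (\<lambda>x. 0)"
    using p(2) by (auto simp: L2_norm_def)
  then obtain x where x: "p x \<noteq> 0"
    by blast
  let ?q = "\<lambda>x. p x *\<^sub>R (axis undefined 1 :: real^'n)"
  have L: "p \<in> L2 \<Omega>" "?q \<in> L2 \<Omega>"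
    using test_function_L2[OF \<Omega>s p(1)] test_field_L2[OF \<Omega>s test_field_axis[OF p(1), of undefined]] .
  show "\<rho> \<noteq> 0"
  proof
    assume "\<rho> = 0"
    then have "op_H \<rho> \<eta> (p, \<lambda>x. 0) = op_H \<rho> \<eta> (\<lambda>x. 0, \<lambda>x. 0)"
      by (simp add: op_H_def)
    then have "p = (\<lambda>x. 0)"
      using inj_onD[OF inj] L by (auto simp: L2_state_def L2_zero)
    with x show False by simp
  qed
  show "\<eta> \<noteq> 0"
  proof
    assume "\<eta> = 0"
    then have "op_H \<rho> \<eta> (\<lambda>x. 0, ?q) = op_H \<rho> \<eta> (\<lambda>x. 0, \<lambda>x. 0)"
      by (simp add: op_H_def)
    then have "?q = (\<lambda>x. 0)"
      using inj_onD[OF inj, of "(\<lambda>x. 0, ?q)" "(\<lambda>x. 0, \<lambda>x. 0)"] L by (auto simp: L2_state_def L2_zero)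
    from fun_cong[OF this, of x] x show False
      by (simp add: axis_eq_0_iff)
  qed
qed

lemma sqrt_sum4_le:
  assumes "0 \<le> a" "0 \<le> b" "0 \<le> c" "0 \<le> d"
  shows "sqrt (a\<^sup>2 + b\<^sup>2 + c\<^sup>2 + d\<^sup>2) \<le> a + b + c + d"
  by (rule real_le_lsqrt) (use assms in \<open>auto simp: power2_sum intro: add_increasing2\<close>)

theorem proposition8:
  fixes \<Omega> :: "(real^'n::finite) set" and \<rho> \<eta> :: real
    and X :: "'n state set" and nrm :: "'n state \<Rightarrow> real"
  assumes "open \<Omega>" and "\<Omega> \<noteq> {}"
    and "\<rho> \<ge> 0" and "\<eta> \<ge> 0"
    and "bij_betw (op_H \<rho> \<eta>) (L2_state \<Omega>) (L2_state \<Omega>)"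
    and "(X, nrm) \<in> {(L2_state \<Omega>, L2_state_norm \<Omega>), (H1_Hdiv \<Omega>, H1_Hdiv_norm \<Omega>)}"
  shows "unbounded_operator X nrm (dom_HinvS \<rho> \<eta> \<Omega> X) (op_HinvS \<rho> \<eta> \<Omega>)"
proof -
  note \<Omega> = open_imp_lebesgue[OF assms(1)]
  interpret G: weak_derivative \<Omega> "has_weak_grad \<Omega>" "grad_tests \<Omega>"
    by (rule weak_derivative_grad[OF assms(1)])
  interpret D: weak_derivative \<Omega> "has_weak_div \<Omega>" "div_tests \<Omega>"
    by (rule weak_derivative_div[OF assms(1)])
  have G_dom: "H1 \<Omega> = G.dom" and D_dom: "Hdiv \<Omega> = D.dom"
    by (auto simp: H1_def G.dom_def Hdiv_def D.dom_def)
  have G_der: "weak_grad \<Omega> = G.der" and D_der: "weak_div \<Omega> = D.der"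
    by (auto simp: weak_grad_def G.der_def weak_div_def D.der_def)
  note trans = G_dom D_dom G_der D_der
  have inj: "inj_on (op_H \<rho> \<eta>) (L2_state \<Omega>)"
    using assms(5) by (rule bij_betw_imp_inj_on)
  note nz = op_H_inj_imp_nonzero[OF assms(1,2) inj]
  let ?T = "op_HinvS \<rho> \<eta> \<Omega>"
  let ?H1 = "H1_Hdiv \<Omega>"
  \<comment> \<open>\<open>op_S\<close> exchanges the slots, so the divergence is divided by \<rho>
    and the gradient by \<eta>. Injectivity of \<open>op_H\<close> turns \<open>the_inv_into\<close>
    into this explicit formula.\<close>
  have S: "op_S \<Omega> (p, q) \<in> op_H \<rho> \<eta> ` L2_state \<Omega>"
    and T: "?T (p, q) = (\<lambda>x. (- inverse \<rho>) *\<^sub>R D.der q x, \<lambda>x. (- inverse \<eta>) *\<^sub>R G.der p x)"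
    and T_L2: "?T (p, q) \<in> L2_state \<Omega>"
    if "p \<in> G.dom" "q \<in> D.dom" for p q
  proof -
    let ?y = "(\<lambda>x. (- inverse \<rho>) *\<^sub>R D.der q x, \<lambda>x. (- inverse \<eta>) *\<^sub>R G.der p x)"
    have y: "?y \<in> L2_state \<Omega>"
      using that by (simp only: L2_state_def mem_Times_iff fst_conv snd_conv L2_scaleR G.der_L2 D.der_L2 simp_thms)
    have eq: "op_H \<rho> \<eta> ?y = op_S \<Omega> (p, q)"
      using nz by (simp add: op_H_def op_S_def trans flip: mult.assoc)
    show "op_S \<Omega> (p, q) \<in> op_H \<rho> \<eta> ` L2_state \<Omega>"
      using eq y by (metis imageI)
    show Ty: "?T (p, q) = ?y"
      using the_inv_into_f_f[OF inj y] eq by (simp add: op_HinvS_def op_H_inv_def)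
    show "?T (p, q) \<in> L2_state \<Omega>"
      unfolding Ty by (rule y)
  qed
  have domI: "(p, q) \<in> dom_HinvS \<rho> \<eta> \<Omega> X" if "p \<in> G.dom" "q \<in> D.dom" "(p, q) \<in> X" "?T (p, q) \<in> X" for p q
    using that S by (simp add: dom_HinvS_def H1_Hdiv_def trans)
  \<comment> \<open>In the smaller space the range condition demands second-order regularity of p
    and q; this is what restricts the domain and makes its density nontrivial.\<close>
  have H1I: "?T (p, q) \<in> ?H1" if "p \<in> G.dom" "q \<in> D.dom" "D.der q \<in> G.dom" "G.der p \<in> D.dom" for p q
    unfolding T[OF that(1,2)] using that(3,4)
    by (simp only: H1_Hdiv_def trans mem_Times_iff fst_conv snd_conv G.dom_scaleR D.dom_scaleR simp_thms)
  consider (L2) "X = L2_state \<Omega>" "nrm = L2_state_norm \<Omega>" | (H1) "X = ?H1" "nrm = H1_Hdiv_norm \<Omega>"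
    using assms(6) by auto
  note cases = this

  have dense: "\<exists>y\<in>dom_HinvS \<rho> \<eta> \<Omega> X. nrm (x - y) < \<epsilon>" if x: "x \<in> X" and \<epsilon>: "\<epsilon> > 0" for x \<epsilon>
  proof -
    obtain p q where pq: "x = (p, q)"
      by (cases x)
    show ?thesis
    proof (cases rule: cases)
      case L2
      \<comment> \<open>Here the range condition holds automatically, so density of
        \<open>H1\<close> and \<open>Hdiv\<close> in \<open>L2\<close> is enough.\<close>
      then have "p \<in> L2 \<Omega>" "q \<in> L2 \<Omega>"
        using x by (auto simp: pq L2_state_def)
      then obtain p' q' where p': "p' \<in> G.dom" "L2_norm \<Omega> (\<lambda>x. p x - p' x) < \<epsilon> / 2"
        and q': "q' \<in> D.dom" "L2_norm \<Omega> (\<lambda>x. q x - q' x) < \<epsilon> / 2"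
        using G.dom_dense[of p "\<epsilon> / 2"] D.dom_dense[of q "\<epsilon> / 2"] \<epsilon> by auto
      have "nrm (x - (p', q')) \<le> L2_norm \<Omega> (\<lambda>x. p x - p' x) + L2_norm \<Omega> (\<lambda>x. q x - q' x)"
        unfolding L2(2) pq L2_state_norm_def
        by (simp add: fun_diff_def sqrt_sum_squares_le_sum)
      also have "\<dots> < \<epsilon>"
        using p' q' by simp
      finally have "nrm (x - (p', q')) < \<epsilon>" .
      moreover have "(p', q') \<in> dom_HinvS \<rho> \<eta> \<Omega> X"
        by (rule domI) (use p' q' T_L2 in \<open>auto simp: L2 L2_state_def G.dom_L2 D.dom_L2\<close>)
      ultimately show ?thesis by blast
    next
      case H1
      then have pq_dom: "p \<in> G.dom" "q \<in> D.dom"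
        using x by (auto simp: pq H1_Hdiv_def trans)
      have \<epsilon>4: "\<epsilon> / 4 > 0"
        using \<epsilon> by simp
      obtain p' f where p': "p' \<in> G.dom" "f \<in> L2 \<Omega>"
        and f: "\<And>v k. v \<in> L2 \<Omega> \<Longrightarrow> k \<in> L2 \<Omega> \<Longrightarrow> has_weak_grad \<Omega> v k \<Longrightarrow> L2_inner \<Omega> (G.der p') k = L2_inner \<Omega> f v"
        and p'_lt: "L2_norm \<Omega> (\<lambda>x. p x - p' x) < \<epsilon> / 4" "L2_norm \<Omega> (\<lambda>x. G.der p x - G.der p' x) < \<epsilon> / 4"
        by (rule G.core[OF pq_dom(1) \<epsilon>4]) (rule that)
      obtain q' g where q': "q' \<in> D.dom" "g \<in> L2 \<Omega>"
        and g: "\<And>v k. v \<in> L2 \<Omega> \<Longrightarrow> k \<in> L2 \<Omega> \<Longrightarrow> has_weak_div \<Omega> v k \<Longrightarrow> L2_inner \<Omega> (D.der q') k = L2_inner \<Omega> g v"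
        and q'_lt: "L2_norm \<Omega> (\<lambda>x. q x - q' x) < \<epsilon> / 4" "L2_norm \<Omega> (\<lambda>x. D.der q x - D.der q' x) < \<epsilon> / 4"
        by (rule D.core[OF pq_dom(2) \<epsilon>4]) (rule that)
      \<comment> \<open>The adjoint relation for the gradient, restricted to test functions with
        their classical gradients, is the definition of a weak divergence with value -f.\<close>
      have "has_weak_div \<Omega> (G.der p') (\<lambda>x. - f x)"
        unfolding has_weak_div_iff
      proof
        fix \<phi> assume \<phi>: "\<phi> \<in> test_functions \<Omega>"
        show "L2_inner \<Omega> (G.der p') (classical_grad \<phi>) = - L2_inner \<Omega> (\<lambda>x. - f x) \<phi>"
          using f[OF test_function_L2[OF \<Omega> \<phi>] test_field_L2[OF \<Omega> test_field_classical_grad[OF \<phi>]]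
              has_weak_grad_classical[OF \<Omega> \<phi>]]
          by (simp add: L2_inner_minus_left)
      qed
      then have Gp': "G.der p' \<in> D.dom"
        by (rule D.domI[OF G.der_L2[OF p'(1)] L2_uminus[OF p'(2)]])
      \<comment> \<open>Dually, restriction to the fields \<phi> times a unit vector, whose
        divergence is a partial derivative of \<phi>, gives a weak gradient.\<close>
      have "has_weak_grad \<Omega> (D.der q') (\<lambda>x. - g x)"
        unfolding has_weak_grad_iff
      proof (intro ballI allI)
        fix \<phi> i assume \<phi>: "\<phi> \<in> test_functions \<Omega>"
        note v = test_field_axis[OF \<phi>, of i]
        show "L2_inner \<Omega> (D.der q') (partial_deriv i \<phi>) = - L2_inner \<Omega> (\<lambda>x. - g x) (\<lambda>x. \<phi> x *\<^sub>R axis i 1)"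
          using g[OF test_field_L2[OF \<Omega> v] test_function_L2[OF \<Omega> test_function_classical_div[OF v]]
              has_weak_div_classical[OF \<Omega> v]]
          by (simp add: L2_inner_minus_left classical_div_axis)
      qed
      then have Dq': "D.der q' \<in> G.dom"
        by (rule G.domI[OF D.der_L2[OF q'(1)] L2_uminus[OF q'(2)]])
      have "nrm (x - (p', q')) = sqrt ((L2_norm \<Omega> (\<lambda>x. p x - p' x))\<^sup>2
          + (L2_norm \<Omega> (\<lambda>x. G.der p x - G.der p' x))\<^sup>2
          + (L2_norm \<Omega> (\<lambda>x. q x - q' x))\<^sup>2 + (L2_norm \<Omega> (\<lambda>x. D.der q x - D.der q' x))\<^sup>2)"
        using G.L2_norm_der_diff[OF pq_dom(1) p'(1)] D.L2_norm_der_diff[OF pq_dom(2) q'(1)]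
        unfolding H1(2) pq H1_Hdiv_norm_def by (simp add: fun_diff_def trans)
      also have "\<dots> \<le> L2_norm \<Omega> (\<lambda>x. p x - p' x) + L2_norm \<Omega> (\<lambda>x. G.der p x - G.der p' x)
          + L2_norm \<Omega> (\<lambda>x. q x - q' x) + L2_norm \<Omega> (\<lambda>x. D.der q x - D.der q' x)"
        by (intro sqrt_sum4_le L2_norm_nonneg)
      also have "\<dots> < \<epsilon>"
        using p'_lt q'_lt by linarith
      finally have "nrm (x - (p', q')) < \<epsilon>" .
      moreover have "(p', q') \<in> dom_HinvS \<rho> \<eta> \<Omega> X"
        by (rule domI) (use p'(1) q'(1) H1I[OF p'(1) q'(1) Dq' Gp'] in \<open>auto simp: H1(1) H1_Hdiv_def trans\<close>)
      ultimately show ?thesis by blast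
    qed
  qed

  have unbounded: "\<exists>x\<in>dom_HinvS \<rho> \<eta> \<Omega> X. c * nrm x < nrm (?T x)" if c: "c \<ge> 0" for c
  proof -
    \<comment> \<open>\<kappa> is the factor with which the gradient of p appears in the image of
      (p, 0). Dividing it by c + 1 rather than c covers c = 0 and makes c * \<delta> < \<kappa>
      strict.\<close>
    define \<kappa> where "\<kappa> = inverse \<bar>\<eta>\<bar>"
    define \<delta> where "\<delta> = \<kappa> / (c + 1)"
    have \<kappa>: "\<kappa> > 0"
      using nz by (simp add: \<kappa>_def)
    have \<delta>: "\<delta> > 0" "c * \<delta> < \<kappa>"
      using \<kappa> c by (auto simp: \<delta>_def field_simps)
    obtain p where p: "p \<in> test_functions \<Omega>" and pos: "0 < L2_norm \<Omega> p"
      and le: "L2_norm \<Omega> p \<le> \<delta> * L2_norm \<Omega> (classical_grad p)"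
      using concentrated_test_function[OF assms(1,2) \<delta>(1)] by blast
    let ?z = "\<lambda>x::real^'n. 0 :: real^'n"
    let ?N = "L2_norm \<Omega> (classical_grad p)" and ?L = "L2_norm \<Omega> (classical_div (classical_grad p))"
    have N: "?N > 0"
      using pos le \<delta>(1) by (smt (verit) mult_nonneg_nonpos)
    have pL: "p \<in> L2 \<Omega>" and gf: "classical_grad p \<in> test_fields \<Omega>" and gL: "classical_grad p \<in> L2 \<Omega>"
      and lL: "classical_div (classical_grad p) \<in> L2 \<Omega>"
      using p by (simp_all add: test_function_L2[OF \<Omega>] test_field_L2[OF \<Omega>]
          test_field_classical_grad test_function_classical_div)
    note pg = has_weak_grad_classical[OF \<Omega> p]
    have p_dom: "p \<in> G.dom"
      by (rule G.domI[OF pL gL pg])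
    note der_p = G.L2_norm_der[OF pL gL pg]
    have T1: "L2_norm \<Omega> (snd (?T (p, ?z))) = \<kappa> * ?N"
      unfolding T[OF p_dom D.zero_dom] snd_conv L2_norm_scaleR by (simp add: der_p \<kappa>_def abs_inverse)
    show ?thesis
    proof (cases rule: cases)
      case L2
      have "(p, ?z) \<in> dom_HinvS \<rho> \<eta> \<Omega> X"
        by (rule domI[OF p_dom D.zero_dom])
          (use T_L2[OF p_dom D.zero_dom] in \<open>auto simp: L2(1) L2_state_def pL L2_zero\<close>)
      moreover have "c * nrm (p, ?z) < nrm (?T (p, ?z))"
      proof -
        have "c * nrm (p, ?z) = c * L2_norm \<Omega> p"
          unfolding L2(2) by (simp add: L2_state_norm_def) (simp add: L2_norm_def)
        also have "\<dots> \<le> c * \<delta> * ?N"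
          using mult_left_mono[OF le c] by (simp add: mult_ac)
        also have "\<dots> < \<kappa> * ?N"
          using \<delta>(2) N by simp
        also have "\<dots> \<le> nrm (?T (p, ?z))"
          unfolding L2(2) T1[symmetric] L2_state_norm_def by (simp add: case_prod_beta real_le_rsqrt)
        finally show ?thesis .
      qed
      ultimately show ?thesis by blast
    next
      case H1
      \<comment> \<open>The chosen weak gradient of p agrees with the classical one only almost
        everywhere, so its divergence has to be transferred.\<close>
      have rel_div: "has_weak_div \<Omega> (G.der p) (classical_div (classical_grad p))"
      proof (rule D.rel_cong_AE[OF gL lL has_weak_div_classical[OF \<Omega> gf] G.der_L2[OF p_dom]])
        show "AE x in lebesgue_on \<Omega>. classical_grad p x = G.der p x"
          using G.der_unique[OF pL gL pg] by eventually_elim simp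
      qed
      note Gp_dom = D.domI[OF G.der_L2[OF p_dom] lL rel_div]
      \<comment> \<open>The chosen divergence of the zero field is a null function, not necessarily
        0, so its membership in \<open>H1\<close> requires an argument.\<close>
      have D0: "D.der ?z \<in> G.dom"
      proof (rule G.dom_cong_AE[OF G.zero_dom D.der_L2[OF D.zero_dom]])
        show "AE x in lebesgue_on \<Omega>. 0 = D.der ?z x"
          using D.der_unique[OF L2_zero L2_zero D.zero_rel] by eventually_elim simp
      qed
      have "(p, ?z) \<in> dom_HinvS \<rho> \<eta> \<Omega> X"
        by (rule domI[OF p_dom D.zero_dom])
          (use H1I[OF p_dom D.zero_dom D0 Gp_dom] p_dom D.zero_dom in \<open>auto simp: H1(1) H1_Hdiv_def trans\<close>)
      moreover have "c * nrm (p, ?z) < nrm (?T (p, ?z))"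
      proof -
        have T2: "L2_norm \<Omega> (D.der (snd (?T (p, ?z)))) = \<kappa> * ?L"
          unfolding T[OF p_dom D.zero_dom] snd_conv
            D.L2_norm_der[OF L2_scaleR[OF G.der_L2[OF p_dom]] L2_scaleR[OF lL]
              D.rel_scaleR[OF G.der_L2[OF p_dom] lL rel_div]] L2_norm_scaleR
          by (simp add: \<kappa>_def abs_inverse)
        \<comment> \<open>The estimate for p is lifted by one derivative: the Laplacian bound
          combined with \<open>le\<close> leaves a common factor \<open>?N\<close>, which is
          positive.\<close>
        have "?N * ?N \<le> ?N * (\<delta> * ?L)"
        proof -
          have "?N * ?N \<le> ?L * L2_norm \<Omega> p"
            using classical_grad_norm_le_laplacian[OF \<Omega> p] by (simp add: power2_eq_square)
          also have "\<dots> \<le> ?L * (\<delta> * ?N)"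
            by (intro mult_left_mono le L2_norm_nonneg)
          finally show ?thesis
            by (simp add: mult_ac)
        qed
        then have le2: "?N \<le> \<delta> * ?L"
          using N by simp
        \<comment> \<open>The norms of p and \<nabla>p are at most \<delta> times those of \<nabla>p
          and \<Delta>p respectively, so both graph norms are compared through
          \<open>?R\<close>.\<close>
        let ?R = "sqrt (?N\<^sup>2 + ?L\<^sup>2)"
        have R: "?R > 0"
          using N by (simp add: add_pos_nonneg)
        have "nrm (p, ?z) = sqrt ((L2_norm \<Omega> p)\<^sup>2 + ?N\<^sup>2)"
          unfolding H1(2) by (simp add: H1_Hdiv_norm_def trans der_p D.L2_norm_der_zero) (simp add: L2_norm_def)
        also have "\<dots> \<le> sqrt ((\<delta> * ?N)\<^sup>2 + (\<delta> * ?L)\<^sup>2)"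
          using power_mono[OF le L2_norm_nonneg, of 2] power_mono[OF le2 L2_norm_nonneg, of 2]
          by (intro real_sqrt_le_mono add_mono)
        also have "\<dots> = \<delta> * ?R"
          using \<delta>(1) by (simp add: power_mult_distrib real_sqrt_mult flip: distrib_left)
        finally have "c * nrm (p, ?z) \<le> c * \<delta> * ?R"
          using c by (simp add: mult_left_mono mult.assoc)
        also have "\<dots> < \<kappa> * ?R"
          using \<delta>(2) R by simp
        also have "\<dots> = sqrt ((\<kappa> * ?N)\<^sup>2 + (\<kappa> * ?L)\<^sup>2)"
          using \<kappa> by (simp add: power_mult_distrib real_sqrt_mult flip: distrib_left)
        \<comment> \<open>The first component of the image contributes only nonnegative squares,
          which are dropped.\<close>
        also have "\<dots> \<le> nrm (?T (p, ?z))"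
          unfolding H1(2) T1[symmetric] T2[symmetric] H1_Hdiv_norm_def by (simp add: case_prod_beta trans)
        finally show ?thesis .
      qed
      ultimately show ?thesis by blast
    qed
  qed

  show ?thesis
    unfolding unbounded_operator_def
  proof (intro conjI)
    show "dom_HinvS \<rho> \<eta> \<Omega> X \<subseteq> X" "?T ` dom_HinvS \<rho> \<eta> \<Omega> X \<subseteq> X"
      by (auto simp: dom_HinvS_def)
    show "\<forall>x\<in>X. \<forall>\<epsilon>>0. \<exists>y\<in>dom_HinvS \<rho> \<eta> \<Omega> X. nrm (x - y) < \<epsilon>"
      using dense by blast
    show "\<not> (\<exists>c\<ge>0. \<forall>x\<in>dom_HinvS \<rho> \<eta> \<Omega> X. nrm (?T x) \<le> c * nrm x)"
      using unbounded by (meson not_less)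
  qed
qed

end
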